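(* For every $\lambda>0$ and $d\ge0$ there exists a collection $\{f^{(\lambda)}_{d,\beta}\}_{\beta\in\mathcal{X}_d}$ of functions $f^{(\lambda)}_{d,\beta}:\mathcal{X}_d\to\mathbb{R}$, not depending on $s$, such that for every $s\in[0,1]$, $$\forall t,t'\in\mathcal{X}_d,\quad L_d(t,t')=\sum_{\beta\in\mathcal{X}_d}s^{|\beta|-1}f^{(\lambda)}_{d,\beta}(t)f^{(\lambda)}_{d,\beta}(t'),$$ and moreover: (1) $f^{(\lambda)}_{d,\bullet}(t)=1$ for all $t\in\mathcal{X}_d$; (2) for all $\beta,\beta'\in\mathcal{X}_d$, $\sum_{t\in\mathcal{X}_d}\mathrm{GW}^{(\lambda)}_d(t)f^{(\lambda)}_{d,\beta}(t)f^{(\lambda)}_{d,\beta'}(t)=\mathbf{1}_{\beta=\beta'}$; (3) for all $t,t'\in\mathcal{X}_d$, $\sum_{\beta\in\mathcal{X}_d}f^{(\lambda)}_{d,\beta}(t)f^{(\lambda)}_{d,\beta}(t')=\mathbf{1}_{t=t'}/\mathrm{GW}^{(\lambda)}_d(t)$; (4) for all $n\ge2$, $d\ge1$ and $\beta^{(1)}=\{\beta^{(1)}_\gamma\}_{\gamma\in\mathcal{X}_{d-1}},\dots,\beta^{(n)}=\{\beta^{(n)}_\gamma\}_{\gamma\in\mathcal{X}_{d-1}}\in\mathcal{X}_d$, $$\sum_{t\in\mathcal{X}_d}\mathrm{GW}^{(\lambda)}_d(t)f^{(\lambda)}_{d,\beta^{(1)}}(t)\cdots f^{(\lambda)}_{d,\beta^{(n)}}(t)\xrightarrow[\lambda\to\infty]{}\prod_{\gamma\in\mathcal{X}_{d-1}}\sqrt{\prod_{i=1}^n\beta^{(i)}_\gamma!}\,\Big[x_1^{\beta^{(1)}_\gamma}\cdots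 x_n^{\beta^{(n)}_\gamma}\Big]\exp\Big(\sum_{1\le i<j\le n}x_ix_j\Big).$$
   Context: Rooted unlabeled trees: $\mathcal{X}_0=\{\bullet\}$ consists of the trivial tree. For $d\ge1$, an element $t\in\mathcal{X}_d$ is a family $t=\{N_\tau\}_{\tau\in\mathcal{X}_{d-1}}$ of non-negative integers with finite support ($N_\tau$ is the number of children of the root whose subtree is $\tau$). The size is $|\bullet|=1$ and $|t|=1+\sum_\tau N_\tau|\tau|$. Galton–Watson law: for $\mu>0$, $\mathrm{GW}^{(\mu)}_0$ is the Dirac mass at $\bullet$, and for $d\ge1$, $t=\{N_\tau\}\sim \mathrm{GW}^{(\mu)}_d$ means the $N_\tau$ are independent with $N_\tau\sim\mathrm{Poisson}(\mu\,\mathrm{GW}^{(\mu)}_{d-1}(\tau))$. Null model: $\mathbb{P}^{(\lambda,0)}_d=\mathrm{GW}^{(\lambda)}_d\otimes\mathrm{GW}^{(\lambda)}_d$. Correlated model $\mathbb{P}^{(\lambda,s)}_d$ ($\lambda>0$, $s\in[0,1]$): $\mathbb{P}^{(\lambda,s)}_0$ is the Dirac mass at $(\bullet,\bullet)$; for $d\ge1$, $(t,t')\sim\mathbb{P}^{(\lambda,s)}_d$ is sampled as $N_\tau=\Delta_\tau+\sum_{\tau'}M_{\tau,\tau'}$, $N'_{\tau'}=\Delta'_{\tau'}+\sum_{\tau}M_{\tau,\tau'}$, with all $\Delta_\tau,\Delta'_\tau,M_{\tau,\tau'}$ independent Poisson with parameters $\lambda(1-s)\mathrm{GW}^{(\lambda)}_{d-1}(\tau)$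 for $\Delta_\tau,\Delta'_\tau$ and $\lambda s\,\mathbb{P}^{(\lambda,s)}_{d-1}(\tau,\tau')$ for $M_{\tau,\tau'}$. Likelihood ratio: $L_d(t,t')=\mathbb{P}^{(\lambda,s)}_d(t,t')/\mathbb{P}^{(\lambda,0)}_d(t,t')$. For a formal power series $f$ in variables $x_1,\dots,x_n$, $[x_1^{m_1}\cdots x_n^{m_n}]f$ denotes the coefficient of that monomial. In (4), only finitely many $\gamma$ have some $\beta^{(i)}_\gamma\neq0$, and the factors for the other $\gamma$ equal $1$. *)

theory Defs
  imports "HOL-Analysis.Analysis" "HOL-Library.Multiset"
begin

text \<open>A rooted unlabeled tree is the multiset of the subtrees of the children of its root.
  An element t of X_d (a family N_tau of counts indexed by X_(d-1)) is represented by the tree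
  whose root has N_tau children with subtree tau; N_tau = count (children t) tau.
  X_d is thus the set of trees of height at most d; the trivial tree is leaf.\<close>

datatype tree = Node "tree multiset"

definition leaf :: tree where "leaf = Node {#}"

primrec children :: "tree \<Rightarrow> tree multiset" where
  "children (Node M) = M"

primrec tsize :: "tree \<Rightarrow> nat" where
  "tsize (Node M) = 1 + sum_mset (image_mset tsize M)"

primrec theight :: "tree \<Rightarrow> nat" where
  "theight (Node M) = Max (insert 0 (Suc ` set_mset (image_mset theight M)))"

definition X :: "nat \<Rightarrow> tree set" where
  "X d = {t. theight t \<le> d}"

text \<open>For a countable index set I, means m i \<ge> 0 with summable sum, and counts k of finite
  support in I, pois_family I m k is the probability that independent Poisson(m i) variables
  (i in I) take the values k i, i.e. the product over I of exp(-m i) * m i ^ k i / k i!.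
  The factors with k i = 0 contribute exp(-m i), collected into exp(- sum of all means).\<close>

definition pois_family :: "'a set \<Rightarrow> ('a \<Rightarrow> real) \<Rightarrow> ('a \<Rightarrow> nat) \<Rightarrow> real" where
  "pois_family I m k =
     (if (\<forall>i. k i \<noteq> 0 \<longrightarrow> i \<in> I) \<and> finite {i. k i \<noteq> 0}
      then exp (- (\<Sum>\<^sub>\<infinity>i\<in>I. m i)) * (\<Prod>i\<in>{i. k i \<noteq> 0}. m i ^ k i / fact (k i))
      else 0)"

fun GW :: "real \<Rightarrow> nat \<Rightarrow> tree \<Rightarrow> real" where
  "GW \<mu> 0 t = (if t = leaf then 1 else 0)"
| "GW \<mu> (Suc d) t =
     (if t \<in> X (Suc d)
      then pois_family (X d) (\<lambda>\<tau>. \<mu> * GW \<mu> d \<tau>) (count (children t))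
      else 0)"

definition rowsum :: "(tree \<times> tree \<Rightarrow> nat) \<Rightarrow> tree \<Rightarrow> nat" where
  "rowsum M \<tau> = (\<Sum>\<tau>'\<in>{\<tau>'. M (\<tau>, \<tau>') \<noteq> 0}. M (\<tau>, \<tau>'))"

definition colsum :: "(tree \<times> tree \<Rightarrow> nat) \<Rightarrow> tree \<Rightarrow> nat" where
  "colsum M \<tau>' = (\<Sum>\<tau>\<in>{\<tau>. M (\<tau>, \<tau>') \<noteq> 0}. M (\<tau>, \<tau>'))"

text \<open>Admissible values of the matrix (M_(tau,tau')) given the observed children counts
  N = children t and N' = children t': Delta_tau = N_tau - sum_tau' M_(tau,tau') \<ge> 0 and
  Delta'_tau' = N'_tau' - sum_tau M_(tau,tau') \<ge> 0 (this forces finite support).\<close>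

definition couplings :: "tree multiset \<Rightarrow> tree multiset \<Rightarrow> (tree \<times> tree \<Rightarrow> nat) set" where
  "couplings N N' = {M. (\<forall>p. M p \<noteq> 0 \<longrightarrow> p \<in> set_mset N \<times> set_mset N') \<and>
                        (\<forall>\<tau>. rowsum M \<tau> \<le> count N \<tau>) \<and> (\<forall>\<tau>'. colsum M \<tau>' \<le> count N' \<tau>')}"

text \<open>Pcorr lam s d (t, t') is the probability of (t,t') under P^(lam,s)_d: the sum over the
  possible values of the M_(tau,tau') of the joint probability of the independent Poisson
  variables M, Delta, Delta'.\<close>

fun Pcorr :: "real \<Rightarrow> real \<Rightarrow> nat \<Rightarrow> tree \<Rightarrow> tree \<Rightarrow> real" where
  "Pcorr lam s 0 t t' = (if t = leaf \<and> t' = leaf then 1 else 0)"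
| "Pcorr lam s (Suc d) t t' =
     (if t \<in> X (Suc d) \<and> t' \<in> X (Suc d)
      then (\<Sum>M\<in>couplings (children t) (children t').
              pois_family (X d \<times> X d) (\<lambda>(\<tau>, \<tau>'). lam * s * Pcorr lam s d \<tau> \<tau>') M
            * pois_family (X d) (\<lambda>\<tau>. lam * (1 - s) * GW lam d \<tau>)
                (\<lambda>\<tau>. count (children t) \<tau> - rowsum M \<tau>)
            * pois_family (X d) (\<lambda>\<tau>'. lam * (1 - s) * GW lam d \<tau>')
                (\<lambda>\<tau>'. count (children t') \<tau>' - colsum M \<tau>'))
      else 0)"

text \<open>Likelihood ratio L_d = P^(lam,s)_d / P^(lam,0)_d, with P^(lam,0)_d = GW (x) GW.\<close>

definition LR :: "real \<Rightarrow> real \<Rightarrow> nat \<Rightarrow> tree \<Rightarrow> tree \<Rightarrow> real" where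
  "LR lam s d t t' = Pcorr lam s d t t' / (GW lam d t * GW lam d t')"

text \<open>A formal power series is its coefficient function on exponent vectors (nat \<Rightarrow> nat,
  finitely supported). Only the operations needed are defined.\<close>

type_synonym mps = "(nat \<Rightarrow> nat) \<Rightarrow> real"

definition mps_X :: "nat \<Rightarrow> mps" where
  "mps_X i = (\<lambda>m. if m = (\<lambda>j. if j = i then 1 else 0) then 1 else 0)"

definition mps_one :: mps where
  "mps_one = (\<lambda>m. if m = (\<lambda>_. 0) then 1 else 0)"

definition mps_mult :: "mps \<Rightarrow> mps \<Rightarrow> mps" where
  "mps_mult f g = (\<lambda>m. \<Sum>a\<in>{a. \<forall>i. a i \<le> m i}. f a * g (\<lambda>i. m i - a i))"

primrec mps_pow :: "mps \<Rightarrow> nat \<Rightarrow> mps" where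
  "mps_pow f 0 = mps_one"
| "mps_pow f (Suc k) = mps_mult f (mps_pow f k)"

definition mdeg :: "(nat \<Rightarrow> nat) \<Rightarrow> nat" where
  "mdeg m = (\<Sum>i\<in>{i. m i \<noteq> 0}. m i)"

text \<open>Exponential of a series f with zero constant term: exp f = sum_k f^k / k!; the coefficient
  of x^m only receives contributions from k \<le> total degree of m.\<close>

definition mps_exp :: "mps \<Rightarrow> mps" where
  "mps_exp f = (\<lambda>m. \<Sum>k\<le>mdeg m. mps_pow f k m / fact k)"

definition pair_sum :: "nat \<Rightarrow> mps" where
  "pair_sum n = (\<lambda>m. \<Sum>p\<in>{(i, j). 1 \<le> i \<and> i < j \<and> j \<le> n}.
                        mps_mult (mps_X (fst p)) (mps_X (snd p)) m)"

end

theory Submission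
  imports Defs
begin

text \<open>At depth d + 1, f_\<beta> is a multivariate Charlier polynomial in the point measure of the children
  of the root, built on the orthonormal family of depth d and divided by sqrt (\<beta>!). Adding a point to
  a Poisson family (Mecke's formula) turns the recursions of these polynomials in their two arguments
  into recursions for their moments and for the kernel SUM \<beta>. s^(|\<beta>| - 1) f_\<beta>(t) f_\<beta>(t'). The kernel
  recursion is that of the likelihood ratio, obtained by removing one child from t and asking whether
  it is matched; at s = 1 it yields completeness. As lam tends to infinity, in the recursion for the
  moments every contraction of three or more factors carries a negative power of lam and its
  coefficient, a moment at depth d, stays bounded, so only pairings survive; they satisfy the
  recursion D_i E = (SUM j \<noteq> i. x_j) E of E = exp (SUM i < j. x_i x_j).\<close>

section \<open>Weighted sums over finite multisets\<close>

text \<open>The children of the root of a Galton-Watson tree form a Poisson family of intensity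
  \<open>lam * GW lam d\<close>. For a label g the statistic (SUM x : t. F g x) / sqrt lam has
  variance 1; its mean is sqrt lam if g = \<open>leaf\<close> and 0 otherwise, because F leaf = 1 is
  orthogonal to every other F g. Subtracting this mean is the origin of the constant
  \<open>- sqrt lam\<close>. A contraction of k labels at one point has weight lam ^ (1 - k / 2):
  one factor lam from Mecke's formula and 1 / sqrt lam for each label. The case k = 1 diverges, but
  the centring cancels it exactly for each lam; k = 2 has weight 1. Two obstacles shape the
  induction on depth. Orthonormality does not make products of three or more functions F g summable,
  so summability of all moments, and later their convergence in lam, is carried from each depth to
  the next. And the normalising exponential of the correlated model at depth d + 1 contains the
  total mass of the model at depth d, so that mass has to be identified before the recursion of the
  likelihood ratio is available.\<close>

definition msets :: "'a set \<Rightarrow> 'a multiset set" where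
  "msets A = {M. set_mset M \<subseteq> A}"

definition mfact :: "'a multiset \<Rightarrow> real" where
  "mfact M = (\<Prod>x\<in>set_mset M. fact (count M x))"

text \<open>Up to the factor exp (- total mass of m), this is the probability that a Poisson family
  of intensity m takes the value M.\<close>

definition mweight :: "('a \<Rightarrow> real) \<Rightarrow> 'a multiset \<Rightarrow> real" where
  "mweight m M = (\<Prod>x\<in>#M. m x) / mfact M"

lemma msets_empty [simp]: "{#} \<in> msets A"
  by (simp add: msets_def)

lemma msets_add_mset [simp]: "add_mset x M \<in> msets A \<longleftrightarrow> x \<in> A \<and> M \<in> msets A"
  by (auto simp: msets_def)

lemma msets_diff [simp]: "M \<in> msets A \<Longrightarrow> M - N \<in> msets A"
  by (auto simp: msets_def dest: in_diffD)

lemma msets_member: "M \<in> msets A \<Longrightarrow> x \<in># M \<Longrightarrow> x \<in> A"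
  by (auto simp: msets_def)

lemma mfact_empty [simp]: "mfact {#} = 1"
  by (simp add: mfact_def)

lemma mfact_superset:
  assumes "finite S" "set_mset M \<subseteq> S"
  shows "mfact M = (\<Prod>x\<in>S. fact (count M x))"
  unfolding mfact_def using assms
  by (intro prod.mono_neutral_left) (auto simp: not_in_iff)

lemma mfact_pos: "mfact M > 0"
  unfolding mfact_def by (intro prod_pos) auto

lemma mfact_nonzero [simp]: "mfact M \<noteq> 0"
  using mfact_pos[of M] by simp

lemma mfact_add_mset: "mfact (add_mset x M) = real (Suc (count M x)) * mfact M"
proof -
  let ?S = "insert x (set_mset M)"
  have "mfact (add_mset x M) = (\<Prod>y\<in>?S. fact (count (add_mset x M) y))"
    by (intro mfact_superset) auto
  also have "\<dots> = fact (Suc (count M x)) * (\<Prod>y\<in>?S - {x}. fact (count (add_mset x M) y))"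
    by (subst prod.remove[where x = x]) auto
  also have "(\<Prod>y\<in>?S - {x}. fact (count (add_mset x M) y)) = (\<Prod>y\<in>?S - {x}. fact (count M y) :: real)"
    by (intro prod.cong) auto
  also have "fact (Suc (count M x)) * \<dots> = real (Suc (count M x)) * (\<Prod>y\<in>?S. fact (count M y))"
    by (subst prod.remove[where x = x and A = ?S]) auto
  also have "(\<Prod>y\<in>?S. fact (count M y)) = mfact M"
    by (intro mfact_superset[symmetric]) auto
  finally show ?thesis .
qed

lemma mweight_empty [simp]: "mweight m {#} = 1"
  by (simp add: mweight_def)

text \<open>The pointwise form of Mecke's formula: marking one copy of x in M + x corresponds to
  adding a fresh x to M with intensity m x.\<close>

lemma mweight_add_mset: "real (Suc (count M x)) * mweight m (add_mset x M) = m x * mweight m M"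
  by (simp add: mweight_def mfact_add_mset del: of_nat_Suc)

lemma mweight_remove:
  assumes "x \<in># M"
  shows "real (count M x) * mweight m M = m x * mweight m (M - {#x#})"
proof -
  from assms obtain N where "M = add_mset x N" by (meson multi_member_split)
  then show ?thesis using mweight_add_mset[of N x m] by simp
qed

lemma mweight_scale: "mweight (\<lambda>x. c * m x) M = c ^ size M * mweight m M"
  unfolding mweight_def by (induction M) (auto simp: prod_mset.distrib)

lemma mweight_nonneg:
  assumes "\<And>x. x \<in># M \<Longrightarrow> m x \<ge> 0"
  shows "mweight m M \<ge> 0"
proof -
  have "(\<Prod>x\<in>#M. m x) \<ge> 0"
    using assms by (induction M) auto
  then show ?thesis using mfact_pos[of M] by (simp add: mweight_def)
qed

lemma mweight_pos:
  assumes "\<And>x. x \<in># M \<Longrightarrow> m x > 0"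
  shows "mweight m M > 0"
proof -
  have "(\<Prod>x\<in>#M. m x) > 0"
    using assms by (induction M) auto
  then show ?thesis using mfact_pos[of M] by (simp add: mweight_def)
qed

lemma sum_mset_sum_count: "(\<Sum>x\<in>#M. (f x :: real)) = (\<Sum>x\<in>set_mset M. real (count M x) * f x)"
proof (induction M)
  case (add y M)
  let ?S = "insert y (set_mset M)"
  have "(\<Sum>x\<in>?S. real (count (add_mset y M) x) * f x) =
      (\<Sum>x\<in>?S. real (count M x) * f x + (if x = y then f x else 0))"
    by (intro sum.cong) (auto simp: algebra_simps)
  also have "\<dots> = (\<Sum>x\<in>?S. real (count M x) * f x) + f y"
    by (simp add: sum.distrib sum.delta')
  also have "(\<Sum>x\<in>?S. real (count M x) * f x) = (\<Sum>x\<in>set_mset M. real (count M x) * f x)"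
    by (intro sum.mono_neutral_right) (auto simp: not_in_iff)
  finally show ?case using add by simp
qed simp

text \<open>A product rule: the removed element is either the new c or one already in M. The summand
  may depend on what remains.\<close>

lemma sum_mset_remove1_add_mset:
  fixes \<phi> :: "'a \<Rightarrow> 'a multiset \<Rightarrow> 'b::comm_monoid_add"
  shows "(\<Sum>x\<in>#add_mset c M. \<phi> x (add_mset c M - {#x#})) =
           \<phi> c M + (\<Sum>x\<in>#M. \<phi> x (add_mset c (M - {#x#})))"
proof -
  have "image_mset (\<lambda>x. \<phi> x (add_mset c M - {#x#})) M =
        image_mset (\<lambda>x. \<phi> x (add_mset c (M - {#x#}))) M"
    by (intro image_mset_cong) (auto dest!: multi_member_split)
  then show ?thesis by simp
qed

text \<open>Removing two elements in either order leaves the same remainder. Keeping \<phi>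
  arbitrary lets the induction absorb the new element c into it.\<close>

lemma sum_mset_remove2_commute:
  fixes \<phi> :: "'a \<Rightarrow> 'a \<Rightarrow> 'a multiset \<Rightarrow> 'b::comm_monoid_add"
  shows "(\<Sum>x\<in>#M. \<Sum>y\<in>#M - {#x#}. \<phi> x y (M - {#x#} - {#y#})) =
         (\<Sum>x\<in>#M. \<Sum>y\<in>#M - {#x#}. \<phi> y x (M - {#x#} - {#y#}))"
proof (induction M arbitrary: \<phi>)
  case (add c M)
  have step: "(\<Sum>x\<in>#add_mset c M. \<Sum>y\<in>#add_mset c M - {#x#}. \<phi> x y (add_mset c M - {#x#} - {#y#})) =
     (\<Sum>y\<in>#M. \<phi> c y (M - {#y#})) + ((\<Sum>x\<in>#M. \<phi> x c (M - {#x#})) +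
     (\<Sum>x\<in>#M. \<Sum>y\<in>#M - {#x#}. \<phi> x y (add_mset c (M - {#x#} - {#y#}))))"
    for \<phi> :: "'a \<Rightarrow> 'a \<Rightarrow> 'a multiset \<Rightarrow> 'b"
    by (subst sum_mset_remove1_add_mset
              [where \<phi> = "\<lambda>x N. \<Sum>y\<in>#N. \<phi> x y (N - {#y#})"])
       (subst sum_mset_remove1_add_mset, simp add: sum_mset.distrib)
  show ?case
    unfolding step[of \<phi>] step[of "\<lambda>x y. \<phi> y x"] add[of "\<lambda>x y N. \<phi> x y (add_mset c N)"]
    by (simp add: add_ac)
qed simp

lemma has_sum_sum_mset:
  fixes f :: "'b \<Rightarrow> 'a \<Rightarrow> real"
  assumes "\<And>y. y \<in># M \<Longrightarrow> (f y has_sum v y) A"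
  shows "((\<lambda>x. \<Sum>y\<in>#M. f y x) has_sum (\<Sum>y\<in>#M. v y)) A"
  using assms by (induction M) (auto intro!: has_sum_add)

lemma has_sum_mult_product:
  fixes f :: "'a \<Rightarrow> real" and g :: "'b \<Rightarrow> real"
  assumes f: "(f has_sum u) A" and g: "(g has_sum v) B"
  shows "((\<lambda>(x, y). f x * g y) has_sum (u * v)) (A \<times> B)"
proof (rule has_sum_SigmaI)
  show "((\<lambda>y. case (x, y) of (x, y) \<Rightarrow> f x * g y) has_sum (f x * v)) B" for x
    using has_sum_cmult_right[OF g, of "f x"] by simp
  show "((\<lambda>x. f x * v) has_sum u * v) A"
    using has_sum_cmult_left[OF f, of v] by simp
  have fs: "(\<lambda>x. \<bar>f x\<bar>) summable_on A" and gs: "(\<lambda>y. \<bar>g y\<bar>) summable_on B"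
    using has_sum_imp_summable[OF f] has_sum_imp_summable[OF g]
      summable_on_iff_abs_summable_on_real[of f A] summable_on_iff_abs_summable_on_real[of g B]
    by simp_all
  have "(\<lambda>(x, y). \<bar>f x\<bar> * \<bar>g y\<bar>) summable_on A \<times> B"
    by (rule summable_on_SigmaI[where g = "\<lambda>x. \<bar>f x\<bar> * infsum (\<lambda>y. \<bar>g y\<bar>) B"])
       (use fs gs in \<open>auto intro!: has_sum_cmult_right has_sum_infsum summable_on_cmult_left\<close>)
  then have "(\<lambda>z. norm (case z of (x, y) \<Rightarrow> f x * g y)) summable_on A \<times> B"
    by (simp add: case_prod_unfold abs_mult)
  then show "(\<lambda>(x, y). f x * g y) summable_on A \<times> B"
    by (rule abs_summable_summable)
qed

text \<open>Pairs (x, M) correspond to multisets with a marked element via M + x, and the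
  multiplicity of x there is exactly what \<open>mweight_add_mset\<close> needs. The filter P on the
  remainder serves to restrict the size.\<close>

lemma has_sum_marked_multisets:
  assumes "((\<lambda>(x, M). m x * mweight m M * G x M) has_sum v) (A \<times> {M \<in> msets A. P M})"
  shows "((\<lambda>M. mweight m M * (\<Sum>x\<in>#M. if P (M - {#x#}) then G x (M - {#x#}) else 0)) has_sum v)
           (msets A)"
proof -
  define H where "H x N = (if P N then G x N else 0)" for x N
  have base: "((\<lambda>(x, M). m x * mweight m M * H x M) has_sum v) (A \<times> msets A)"
    using assms
    by (rule has_sum_cong_neutral[THEN iffD1, rotated -1]) (auto simp: H_def split: if_splits)
  have eq: "real (count (add_mset x M) x) * (mweight m (add_mset x M) * H x M) =
      m x * mweight m M * H x M" for x M
    using mweight_add_mset[of M x m] by (simp add: mult.assoc[symmetric] del: of_nat_Suc)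
  have bij: "bij_betw (\<lambda>(x, M). (add_mset x M, x)) (A \<times> msets A) (Sigma (msets A) set_mset)"
    by (rule bij_betwI[where g = "\<lambda>(M, x). (x, M - {#x#})"]) (auto dest: msets_member)
  have "((\<lambda>(M, x). real (count M x) * (mweight m M * H x (M - {#x#}))) has_sum v)
        (Sigma (msets A) set_mset)"
    using has_sum_reindex_bij_betw[OF bij, of
        "\<lambda>(M, x). real (count M x) * (mweight m M * H x (M - {#x#}))" v] base
    by (simp add: case_prod_unfold eq del: count_add_mset)
  then have "((\<lambda>M. \<Sum>x\<in>set_mset M. real (count M x) * (mweight m M * H x (M - {#x#}))) has_sum v) (msets A)"
    by (rule has_sum_SigmaD) simp
  then show ?thesis
    by (simp add: H_def sum_mset_sum_count sum_distrib_left mult.left_commute)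
qed

text \<open>Mecke's formula without the normalising exponential. The sum over pairs is assumed to
  converge, so m and G may be signed.\<close>

lemma has_sum_mecke:
  assumes "((\<lambda>(x, M). m x * mweight m M * G x M) has_sum v) (A \<times> msets A)"
  shows "((\<lambda>M. mweight m M * (\<Sum>x\<in>#M. G x (M - {#x#}))) has_sum v) (msets A)"
  using has_sum_marked_multisets[where m = m and G = G and v = v and A = A and P = "\<lambda>_. True"] assms by simp

text \<open>The multinomial theorem for possibly infinitely many variables. Marking one of the n + 1
  elements gives (n + 1) S (n + 1) = \<mu> S n for the sums S n over size n.\<close>

lemma has_sum_mweight_size:
  assumes "(m has_sum \<mu>) A"
  shows "(mweight m has_sum \<mu> ^ n / fact n) {M \<in> msets A. size M = n}"
proof (induction n)
  case 0
  have "{M \<in> msets A. size M = 0} = {{#}}" by auto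
  then show ?case by (simp add: has_sum_finite_iff)
next
  case (Suc n)
  have "((\<lambda>(x, M). m x * mweight m M * 1) has_sum (\<mu> * (\<mu> ^ n / fact n))) (A \<times> {M \<in> msets A. size M = n})"
    using has_sum_mult_product[OF assms Suc] by simp
  then have "((\<lambda>M. mweight m M * (\<Sum>x\<in>#M. if size (M - {#x#}) = n then 1 else 0)) has_sum
      (\<mu> * (\<mu> ^ n / fact n))) (msets A)"
    by (rule has_sum_marked_multisets)
  then have "((\<lambda>M. mweight m M * real (Suc n)) has_sum (\<mu> * (\<mu> ^ n / fact n))) {M \<in> msets A. size M = Suc n}"
  proof (rule has_sum_cong_neutral[THEN iffD1, rotated -1])
    fix M assume "M \<in> msets A - {M \<in> msets A. size M = Suc n}"
    then have "image_mset (\<lambda>x. if size (M - {#x#}) = n then 1 else 0 :: real) M = image_mset (\<lambda>x. 0) M"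
      by (intro image_mset_cong) (auto dest!: multi_member_split)
    then show "mweight m M * (\<Sum>x\<in>#M. if size (M - {#x#}) = n then 1 else 0) = 0" by simp
  next
    fix M assume "M \<in> msets A \<inter> {M \<in> msets A. size M = Suc n}"
    then have "image_mset (\<lambda>x. if size (M - {#x#}) = n then 1 else 0 :: real) M = image_mset (\<lambda>x. 1) M"
      by (intro image_mset_cong) (auto dest!: multi_member_split)
    then show "mweight m M * (\<Sum>x\<in>#M. if size (M - {#x#}) = n then 1 else 0) = mweight m M * real (Suc n)"
      using \<open>M \<in> _\<close> by (simp del: of_nat_Suc)
  qed auto
  from has_sum_cmult_left[OF this, of "1 / real (Suc n)"] show ?case
    by (simp add: field_simps del: of_nat_Suc)
qed

text \<open>The exponential series, split by size. Nonnegativity of m makes the weights nonnegative,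
  so that summing size by size proves summability over all multisets.\<close>

lemma has_sum_mweight:
  assumes m: "(m has_sum \<mu>) A" and nonneg: "\<And>x. x \<in> A \<Longrightarrow> m x \<ge> 0"
  shows "(mweight m has_sum exp \<mu>) (msets A)"
proof -
  have \<mu>: "\<mu> \<ge> 0" using has_sum_nonneg[OF m] nonneg by auto
  have "(\<lambda>n. \<mu> ^ n / fact n) sums exp \<mu>"
    using exp_converges[of \<mu>] by (simp add: divide_inverse mult.commute)
  then have e: "((\<lambda>n. \<mu> ^ n / fact n) has_sum exp \<mu>) UNIV"
    by (rule sums_nonneg_imp_has_sum) (use \<mu> in auto)
  let ?S = "Sigma UNIV (\<lambda>n. {M \<in> msets A. size M = n})"
  have "((\<lambda>(n, M). mweight m M) has_sum exp \<mu>) ?S"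
  proof (rule has_sum_SigmaI)
    show "(\<lambda>(n, M). mweight m M) summable_on ?S"
      by (rule summable_on_SigmaI[where g = "\<lambda>n. \<mu> ^ n / fact n"])
         (use e has_sum_mweight_size[OF m] in
           \<open>auto intro!: mweight_nonneg nonneg simp: msets_member has_sum_imp_summable\<close>)
  qed (use e has_sum_mweight_size[OF m] in auto)
  then show ?thesis
    by (rule has_sum_reindex_bij_witness[where j = snd and i = "\<lambda>M. (size M, M)", THEN iffD1, rotated -1]) auto
qed

section \<open>Multivariate Charlier polynomials\<close>

text \<open>For a multiset t, the polynomials charlier a c F t b are the coefficients of
  z^b / b! in exp (SUM g. c g * z g) * (PROD x : t. 1 + a * (SUM g. F g x * z g)).\<close>

definition charlier_step :: "real \<Rightarrow> ('b \<Rightarrow> 'a \<Rightarrow> real) \<Rightarrow> 'a \<Rightarrow> ('b multiset \<Rightarrow> real) \<Rightarrow> 'b multiset \<Rightarrow> real" where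
  "charlier_step a F x \<phi> b = \<phi> b + a * (\<Sum>g\<in>#b. F g x * \<phi> (b - {#g#}))"

definition charlier :: "real \<Rightarrow> ('b \<Rightarrow> real) \<Rightarrow> ('b \<Rightarrow> 'a \<Rightarrow> real) \<Rightarrow> 'a multiset \<Rightarrow> 'b multiset \<Rightarrow> real" where
  "charlier a c F t = fold_mset (charlier_step a F) (\<lambda>b. \<Prod>g\<in>#b. c g) t"

text \<open>Makes the fold over the multiset t independent of order. The only term not visibly
  symmetric in x and y is the one of second order, where two labels are removed from b.\<close>

lemma charlier_step_commute:
  "charlier_step a F x (charlier_step a F y \<phi>) = charlier_step a F y (charlier_step a F x \<phi>)"
proof
  fix b
  have "charlier_step a F x (charlier_step a F y \<phi>) b =
      \<phi> b + a * (\<Sum>g\<in>#b. F g y * \<phi> (b - {#g#})) + a * (\<Sum>g\<in>#b. F g x * \<phi> (b - {#g#}))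
      + a\<^sup>2 * (\<Sum>g\<in>#b. \<Sum>h\<in>#b - {#g#}. F g x * F h y * \<phi> (b - {#g#} - {#h#}))" for x y
    by (simp add: charlier_step_def sum_mset.distrib sum_mset_distrib_left
        ring_distribs power2_eq_square mult_ac)
  moreover have "(\<Sum>g\<in>#b. \<Sum>h\<in>#b - {#g#}. F g x * F h y * \<phi> (b - {#g#} - {#h#})) =
      (\<Sum>g\<in>#b. \<Sum>h\<in>#b - {#g#}. F g y * F h x * \<phi> (b - {#g#} - {#h#}))"
    using sum_mset_remove2_commute[of "\<lambda>g h N. F g x * F h y * \<phi> N" b] by (simp add: mult_ac)
  ultimately show "charlier_step a F x (charlier_step a F y \<phi>) b = charlier_step a F y (charlier_step a F x \<phi>) b"
    by simp
qed

lemma charlier_empty_left: "charlier a c F {#} b = (\<Prod>g\<in>#b. c g)"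
  by (simp add: charlier_def)

lemma charlier_add_left:
  "charlier a c F (add_mset x t) b =
     charlier a c F t b + a * (\<Sum>g\<in>#b. F g x * charlier a c F t (b - {#g#}))"
proof -
  interpret comp_fun_commute "charlier_step a F"
    by unfold_locales (auto simp: charlier_step_commute)
  show ?thesis by (simp add: charlier_def charlier_step_def[of _ _ x])
qed

lemma charlier_empty_right [simp]: "charlier a c F t {#} = 1"
  by (induction t) (auto simp: charlier_empty_left charlier_add_left)

text \<open>The derivative of the generating function in z g: it hits either the exponential, giving
  c g, or the factor of one x in t, leaving a * F g x and the product over t without x.\<close>

lemma charlier_add_right:
  "charlier a c F t (add_mset g b) =
     c g * charlier a c F t b + a * (\<Sum>x\<in>#t. F g x * charlier a c F (t - {#x#}) b)"
proof (induction t arbitrary: b)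
  case empty
  then show ?case by (simp add: charlier_empty_left)
next
  case (add y t)
  let ?e = "charlier a c F"
  have "?e (add_mset y t) (add_mset g b) = ?e t (add_mset g b) +
      a * (F g y * ?e t b + (\<Sum>h\<in>#b. F h y * ?e t (add_mset g (b - {#h#}))))"
    using sum_mset_remove1_add_mset[of "\<lambda>h N. F h y * ?e t N" g b]
    by (simp add: charlier_add_left)
  also have "(\<Sum>h\<in>#b. F h y * ?e t (add_mset g (b - {#h#}))) =
      c g * (\<Sum>h\<in>#b. F h y * ?e t (b - {#h#})) +
      a * (\<Sum>h\<in>#b. \<Sum>x\<in>#t. F g x * F h y * ?e (t - {#x#}) (b - {#h#}))"
    by (simp add: add sum_mset.distrib sum_mset_distrib_left ring_distribs mult_ac)
  also have "(\<Sum>h\<in>#b. \<Sum>x\<in>#t. F g x * F h y * ?e (t - {#x#}) (b - {#h#})) =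
      (\<Sum>x\<in>#t. F g x * (\<Sum>h\<in>#b. F h y * ?e (t - {#x#}) (b - {#h#})))"
    by (subst sum_mset.swap) (simp add: sum_mset_distrib_left mult_ac)
  finally have lhs: "?e (add_mset y t) (add_mset g b) = ?e t (add_mset g b) +
      a * (F g y * ?e t b + (c g * (\<Sum>h\<in>#b. F h y * ?e t (b - {#h#})) +
      a * (\<Sum>x\<in>#t. F g x * (\<Sum>h\<in>#b. F h y * ?e (t - {#x#}) (b - {#h#})))))" .
  have "(\<Sum>x\<in>#add_mset y t. F g x * ?e (add_mset y t - {#x#}) b) =
      F g y * ?e t b + (\<Sum>x\<in>#t. F g x * ?e (add_mset y (t - {#x#})) b)"
    using sum_mset_remove1_add_mset[of "\<lambda>x N. F g x * ?e N b" y t] by simp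
  also have "(\<Sum>x\<in>#t. F g x * ?e (add_mset y (t - {#x#})) b) =
      (\<Sum>x\<in>#t. F g x * ?e (t - {#x#}) b) +
      a * (\<Sum>x\<in>#t. F g x * (\<Sum>h\<in>#b. F h y * ?e (t - {#x#}) (b - {#h#})))"
    by (simp add: charlier_add_left sum_mset.distrib sum_mset_distrib_left ring_distribs mult_ac)
  finally have rhs: "(\<Sum>x\<in>#add_mset y t. F g x * ?e (add_mset y t - {#x#}) b) =
      F g y * ?e t b + ((\<Sum>x\<in>#t. F g x * ?e (t - {#x#}) b) +
      a * (\<Sum>x\<in>#t. F g x * (\<Sum>h\<in>#b. F h y * ?e (t - {#x#}) (b - {#h#}))))" .
  show ?case
    unfolding lhs rhs unfolding add charlier_add_left by (simp add: algebra_simps)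
qed

text \<open>The recursion assumed for L determines it, and is also satisfied by the likelihood ratio of the
  correlated model.\<close>

lemma has_sum_charlier_kernel:
  fixes F :: "'b \<Rightarrow> 'a \<Rightarrow> real" and w :: "'b \<Rightarrow> real"
  assumes lam: "lam > 0" and g0: "g0 \<in> B" and F0: "\<And>x. x \<in> A \<Longrightarrow> F g0 x = 1"
    and c: "c = (\<lambda>g. if g = g0 then - sqrt lam else 0)"
    and w: "w g0 = s" "s \<ge> 0"
    and FF: "\<And>x y. x \<in> A \<Longrightarrow> y \<in> A \<Longrightarrow> ((\<lambda>g. w g * F g x * F g y) has_sum s * l x y) B"
    and L0: "\<And>N'. N' \<in> msets A \<Longrightarrow> L {#} N' = exp (lam * s) * (1 - s) ^ size N'"
    and LS: "\<And>x N N'. x \<in> A \<Longrightarrow> N \<in> msets A \<Longrightarrow> N' \<in> msets A \<Longrightarrow>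
        L (add_mset x N) N' = (1 - s) * L N N' + s / lam * (\<Sum>y\<in>#N'. l x y * L N (N' - {#y#}))"
    and N: "N \<in> msets A" "N' \<in> msets A"
  shows "((\<lambda>b. mweight w b * charlier (1 / sqrt lam) c F N b * charlier (1 / sqrt lam) c F N' b)
            has_sum L N N') (msets B)"
proof -
  define a where "a = 1 / sqrt lam"
  let ?e = "charlier a c F"
  define W where "W b = mweight w b" for b
  have aa: "a * a = 1 / lam" and as: "a * sqrt lam = 1"
    using lam by (simp_all add: a_def)
  have as': "a * (u * (sqrt lam * v)) = u * v" for u v
    using lam by (simp add: a_def)
  \<comment> \<open>Since c is supported at g0, only that label contributes, with F g0 x =
    1.\<close>
  have single: "((\<lambda>g. w g * F g x * c g) has_sum - s * sqrt lam) B" if "x \<in> A" for x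
  proof -
    have "((\<lambda>g. w g * F g x * c g) has_sum (\<Sum>g\<in>{g0}. w g * F g x * c g)) {g0}"
      by (intro has_sum_finite) auto
    then have "((\<lambda>g. w g * F g x * c g) has_sum - s * sqrt lam) {g0}"
      using that by (simp add: F0 w c)
    then show ?thesis
      by (rule has_sum_cong_neutral[THEN iffD1, rotated -1]) (use g0 in \<open>auto simp: c\<close>)
  qed
  \<comment> \<open>For two empty multisets both polynomials are products of values of c, so the sum
    is an exponential series with exponent w g0 * lam.\<close>
  have base0: "((\<lambda>b. W b * ?e {#} b * ?e {#} b) has_sum exp (lam * s)) (msets B)"
  proof -
    have "((\<lambda>g. w g * c g * c g) has_sum (\<Sum>g\<in>{g0}. w g * c g * c g)) {g0}"
      by (intro has_sum_finite) auto
    then have "((\<lambda>g. w g * c g * c g) has_sum lam * s) {g0}"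
      using lam by (simp add: w c mult.assoc) (simp add: mult.commute)
    then have "((\<lambda>g. w g * c g * c g) has_sum lam * s) B"
      by (rule has_sum_cong_neutral[THEN iffD1, rotated -1]) (use g0 in \<open>auto simp: c\<close>)
    then have "(mweight (\<lambda>g. w g * c g * c g) has_sum exp (lam * s)) (msets B)"
      by (rule has_sum_mweight) (use w lam in \<open>auto simp: c\<close>)
    moreover have "mweight (\<lambda>g. w g * c g * c g) = (\<lambda>b. W b * ?e {#} b * ?e {#} b)"
      by (simp add: fun_eq_iff mweight_def W_def charlier_empty_left prod_mset.distrib)
    ultimately show ?thesis by simp
  qed
  have mecke: "((\<lambda>b. W b * (\<Sum>g\<in>#b. G g (b - {#g#}))) has_sum v) (msets B)"
    if "((\<lambda>(g, b). w g * W b * G g b) has_sum v) (B \<times> msets B)" for G v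
    using that unfolding W_def by (rule has_sum_mecke)
  have base: "((\<lambda>b. W b * ?e {#} b * ?e N' b) has_sum exp (lam * s) * (1 - s) ^ size N') (msets B)"
    if "N' \<in> msets A" for N'
    using that
  proof (induction N')
    case empty
    then show ?case using base0 by simp
  next
    case (add y N')
    then have y: "y \<in> A" and IH: "((\<lambda>b. W b * ?e {#} b * ?e N' b) has_sum exp (lam * s) * (1 - s) ^ size N') (msets B)"
      by auto
    have "((\<lambda>(g, b). (w g * F g y * c g) * (W b * ?e {#} b * ?e N' b)) has_sum
        - s * sqrt lam * (exp (lam * s) * (1 - s) ^ size N')) (B \<times> msets B)"
      by (rule has_sum_mult_product[OF single[OF y] IH])
    then have "((\<lambda>(g, b). w g * W b * (F g y * ?e {#} (add_mset g b) * ?e N' b)) has_sum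
        - s * sqrt lam * (exp (lam * s) * (1 - s) ^ size N')) (B \<times> msets B)"
      by (simp add: charlier_empty_left mult_ac)
    from mecke[of "\<lambda>g b. F g y * ?e {#} (add_mset g b) * ?e N' b", OF this]
    have "((\<lambda>b. W b * (\<Sum>g\<in>#b. F g y * ?e {#} b * ?e N' (b - {#g#}))) has_sum
        - s * sqrt lam * (exp (lam * s) * (1 - s) ^ size N')) (msets B)"
      by (rule has_sum_cong[THEN iffD1, rotated]) (auto intro!: arg_cong[where f = sum_mset] image_mset_cong)
    from has_sum_add[OF IH has_sum_cmult_right[OF this, of a]]
    show ?case
      by (simp add: charlier_add_left algebra_simps sum_mset_distrib_left as')
  qed
  have "((\<lambda>b. W b * ?e N b * ?e N' b) has_sum L N N') (msets B)"
    using N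
  proof (induction N arbitrary: N')
    case empty
    then show ?case using base L0 by simp
  next
    case (add x N)
    then have x: "x \<in> A" and N: "N \<in> msets A" and N': "N' \<in> msets A"
      and IH: "\<And>N'. N' \<in> msets A \<Longrightarrow> ((\<lambda>b. W b * ?e N b * ?e N' b) has_sum L N N') (msets B)"
      by auto
    \<comment> \<open>\<open>charlier_add_left\<close> at x removes a label g from b. Mecke's
      formula turns this into adding g in the polynomial of N', where
      \<open>charlier_add_right\<close> yields a centring term, treated here, and one term for each
      y in N' that x can be matched with.\<close>
    have "((\<lambda>(g, b). (w g * F g x * c g) * (W b * ?e N b * ?e N' b)) has_sum
        - s * sqrt lam * L N N') (B \<times> msets B)"
      by (rule has_sum_mult_product[OF single[OF x] IH[OF N']])
    moreover have "((\<lambda>(g, b). w g * F g x * F g y * (W b * ?e N b * ?e (N' - {#y#}) b)) has_sum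
        s * l x y * L N (N' - {#y#})) (B \<times> msets B)" if "y \<in># N'" for y
      using that N' by (intro has_sum_mult_product FF IH x) (auto dest: msets_member)
    then have "((\<lambda>z. \<Sum>y\<in>#N'. case z of (g, b) \<Rightarrow> w g * F g x * F g y * (W b * ?e N b * ?e (N' - {#y#}) b)) has_sum
        (\<Sum>y\<in>#N'. s * l x y * L N (N' - {#y#}))) (B \<times> msets B)"
      by (rule has_sum_sum_mset)
    ultimately have "((\<lambda>z. (case z of (g, b) \<Rightarrow> (w g * F g x * c g) * (W b * ?e N b * ?e N' b)) + 
        a * (\<Sum>y\<in>#N'. case z of (g, b) \<Rightarrow> w g * F g x * F g y * (W b * ?e N b * ?e (N' - {#y#}) b))) has_sum
        - s * sqrt lam * L N N' + a * (\<Sum>y\<in>#N'. s * l x y * L N (N' - {#y#}))) (B \<times> msets B)"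
      by (intro has_sum_add has_sum_cmult_right)
    then have "((\<lambda>(g, b). w g * W b * (F g x * ?e N b * ?e N' (add_mset g b))) has_sum
        - s * sqrt lam * L N N' + a * (\<Sum>y\<in>#N'. s * l x y * L N (N' - {#y#}))) (B \<times> msets B)"
      by (rule has_sum_cong[THEN iffD1, rotated])
         (auto simp: charlier_add_right algebra_simps sum_mset_distrib_left)
    from mecke[of "\<lambda>g b. F g x * ?e N b * ?e N' (add_mset g b)", OF this]
    have "((\<lambda>b. W b * (\<Sum>g\<in>#b. F g x * ?e N (b - {#g#}) * ?e N' b)) has_sum
        - s * sqrt lam * L N N' + a * (\<Sum>y\<in>#N'. s * l x y * L N (N' - {#y#}))) (msets B)"
      by (rule has_sum_cong[THEN iffD1, rotated]) (auto intro!: arg_cong[where f = sum_mset] image_mset_cong)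
    from has_sum_add[OF IH[OF N'] has_sum_cmult_right[OF this, of a]]
    have "((\<lambda>b. W b * ?e (add_mset x N) b * ?e N' b) has_sum
        L N N' + a * (- s * sqrt lam * L N N' + a * (\<Sum>y\<in>#N'. s * l x y * L N (N' - {#y#})))) (msets B)"
      by (simp add: charlier_add_left algebra_simps sum_mset_distrib_left)
    \<comment> \<open>With a * sqrt lam = 1 the centring term contributes - s to the coefficient of
      L N N', leaving the weight 1 - s of an unmatched x; a * a = 1 / lam gives the weight of a
      match.\<close>
    also have "L N N' + a * (- s * sqrt lam * L N N' + a * (\<Sum>y\<in>#N'. s * l x y * L N (N' - {#y#}))) =
        (1 - (a * sqrt lam) * s) * L N N' + (a * a) * s * (\<Sum>y\<in>#N'. l x y * L N (N' - {#y#}))"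
      by (simp add: algebra_simps sum_mset_distrib_left)
    also have "\<dots> = L (add_mset x N) N'"
      using LS[OF x N N'] by (simp add: aa as)
    finally show ?case .
  qed
  then show ?thesis by (simp add: W_def a_def)
qed

section \<open>Moments of the Charlier polynomials\<close>

definition total :: "'i set \<Rightarrow> ('i \<Rightarrow> 'b multiset) \<Rightarrow> nat" where
  "total I b = (\<Sum>i\<in>I. size (b i))"

lemma total_remove_le:
  assumes "finite I"
  shows "total I (b(i := b i - {#h#})) \<le> total I b"
  unfolding total_def by (intro sum_mono) (auto simp: size_Diff_submset diff_subset_eq_self size_mset_mono)

lemma nonempty_family_split:
  assumes "finite I" "\<forall>i\<in>I. b i \<in> msets B" "total I b \<noteq> 0"
  obtains i g c where "i \<in> I" "g \<in> B" "c \<in> msets B" "b i = add_mset g c"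
    "\<forall>j\<in>I. (b(i := c)) j \<in> msets B" "total I b = Suc (total I (b(i := c)))"
proof -
  obtain i where i: "i \<in> I" "b i \<noteq> {#}"
    using assms by (auto simp: total_def)
  then obtain g c where gc: "b i = add_mset g c" by (meson multiset_cases)
  have "total I b = size (b i) + (\<Sum>j\<in>I - {i}. size (b j))"
    unfolding total_def using assms(1) i(1) by (rule sum.remove)
  moreover have "total I (b(i := c)) = size c + (\<Sum>j\<in>I - {i}. size ((b(i := c)) j))"
    unfolding total_def using assms(1) i(1) by (subst sum.remove[of I i]) auto
  moreover have "(\<Sum>j\<in>I - {i}. size ((b(i := c)) j)) = (\<Sum>j\<in>I - {i}. size (b j))"
    by (intro sum.cong) auto
  ultimately have "total I b = Suc (total I (b(i := c)))" using gc by simp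
  moreover have "g \<in> B" "c \<in> msets B" using assms(2) i gc by (metis msets_add_mset)+
  ultimately show ?thesis using that i gc assms(2) by auto
qed

text \<open>p is the law of a single child subtree, and F is a family orthonormal in L2 of p that
  contains the constant 1 under the label g0. Both come from depth d, and the results below recreate
  them at depth d + 1. \<open>moments_summable\<close> is a separate assumption because it does not
  follow from orthonormality.\<close>

locale poisson_charlier =
  fixes lam :: real and p :: "'a \<Rightarrow> real" and A :: "'a set"
    and F :: "'b \<Rightarrow> 'a \<Rightarrow> real" and B :: "'b set" and g0 :: 'b
  assumes lam_pos: "lam > 0"
    and p_sum: "(p has_sum 1) A"
    and p_nonneg: "\<And>x. x \<in> A \<Longrightarrow> p x \<ge> 0"
    and g0_in: "g0 \<in> B"
    and F_g0: "\<And>x. x \<in> A \<Longrightarrow> F g0 x = 1"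
    and orthonormal: "\<And>g h. g \<in> B \<Longrightarrow> h \<in> B \<Longrightarrow>
          ((\<lambda>x. p x * F g x * F h x) has_sum (if g = h then 1 else 0)) A"
    and moments_summable: "\<And>gs. gs \<in> msets B \<Longrightarrow> (\<lambda>x. p x * (\<Prod>g\<in>#gs. F g x)) summable_on A"
begin

text \<open>Minus the mean of (SUM x : t. F g x) / sqrt lam under the Poisson law, so that the
  polynomials of degree one are centred.\<close>

definition mean :: "'b \<Rightarrow> real" where
  "mean g = (if g = g0 then - sqrt lam else 0)"

definition ch :: "'a multiset \<Rightarrow> 'b multiset \<Rightarrow> real" where
  "ch = charlier (1 / sqrt lam) mean F"

definition prob :: "'a multiset \<Rightarrow> real" where
  "prob t = exp (- lam) * mweight (\<lambda>x. lam * p x) t"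

definition mom :: "'b multiset \<Rightarrow> real" where
  "mom gs = (\<Sum>\<^sub>\<infinity>x\<in>A. p x * (\<Prod>g\<in>#gs. F g x))"

text \<open>The integrand after one use of Mecke's formula: x is the new point, gs lists the labels
  already contracted at x, the factors in Q still see t with x added, and those outside Q see t
  alone.\<close>

definition mixed :: "'i set \<Rightarrow> 'b multiset \<Rightarrow> 'i set \<Rightarrow> ('i \<Rightarrow> 'b multiset) \<Rightarrow> 'a \<times> 'a multiset \<Rightarrow> real" where
  "mixed I gs Q b = (\<lambda>(x, t). (p x * (\<Prod>g\<in>#gs. F g x)) *
     (prob t * (\<Prod>i\<in>Q. ch (add_mset x t) (b i)) * (\<Prod>i\<in>I - Q. ch t (b i))))"

definition mixed_moment :: "'i set \<Rightarrow> 'b multiset \<Rightarrow> 'i set \<Rightarrow> ('i \<Rightarrow> 'b multiset) \<Rightarrow> real" where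
  "mixed_moment I gs Q b = (\<Sum>\<^sub>\<infinity>z\<in>A \<times> msets A. mixed I gs Q b z)"

definition moment :: "'i set \<Rightarrow> ('i \<Rightarrow> 'b multiset) \<Rightarrow> real" where
  "moment I b = (\<Sum>\<^sub>\<infinity>t\<in>msets A. prob t * (\<Prod>i\<in>I. ch t (b i)))"

lemma prob_sum: "(prob has_sum 1) (msets A)"
proof -
  have "((\<lambda>x. lam * p x) has_sum lam * 1) A"
    by (rule has_sum_cmult_right[OF p_sum])
  then have "(mweight (\<lambda>x. lam * p x) has_sum exp lam) (msets A)"
    using p_nonneg lam_pos by (intro has_sum_mweight) auto
  from has_sum_cmult_right[OF this, of "exp (- lam)"] show ?thesis
    by (simp add: prob_def[abs_def] flip: exp_add)
qed

lemma prob_mecke: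
  assumes "((\<lambda>(x, t). p x * prob t * G x t) has_sum v) (A \<times> msets A)"
  shows "((\<lambda>t. prob t * (\<Sum>x\<in>#t. G x (t - {#x#}))) has_sum lam * v) (msets A)"
proof -
  have "((\<lambda>(x, t). lam * p x * mweight (\<lambda>x. lam * p x) t * (exp (- lam) * G x t)) has_sum lam * v) (A \<times> msets A)"
    using has_sum_cmult_right[OF assms, of lam]
    by (rule has_sum_cong[THEN iffD1, rotated]) (auto simp: prob_def)
  from has_sum_mecke[OF this] show ?thesis
    by (rule has_sum_cong[THEN iffD1, rotated]) (simp add: prob_def mult_ac flip: sum_mset_distrib_left)
qed

lemma mom_single: "g \<in> B \<Longrightarrow> mom {#g#} = (if g = g0 then 1 else 0)"
  unfolding mom_def
  by (intro infsumI has_sum_cong[THEN iffD1, OF _ orthonormal[OF _ g0_in]]) (auto simp: F_g0)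

lemma mom_pair: "g \<in> B \<Longrightarrow> h \<in> B \<Longrightarrow> mom {#g, h#} = (if g = h then 1 else 0)"
  using orthonormal[of g h] unfolding mom_def by (intro infsumI) (simp add: mult_ac)

text \<open>Factor i either ignores x or gives up one label h, which joins gs at the price 1 / sqrt
  lam.\<close>

lemma mixed_insert:
  assumes "finite I" "i \<in> I" "i \<notin> Q" "Q \<subseteq> I"
  shows "mixed I gs (insert i Q) b z =
    mixed I gs Q b z + 1 / sqrt lam * (\<Sum>h\<in>#b i. mixed I (add_mset h gs) Q (b(i := b i - {#h#})) z)"
proof -
  obtain x t where z: "z = (x, t)" by (cases z)
  let ?J = "I - insert i Q"
  have fin: "finite Q" "finite ?J" using assms finite_subset by auto
  have J: "I - Q = insert i ?J" "i \<notin> ?J" using assms by auto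
  have upd: "(\<Prod>j\<in>Q. f ((b(i := c)) j)) = (\<Prod>j\<in>Q. f (b j))"
    "(\<Prod>j\<in>?J. f ((b(i := c)) j)) = (\<Prod>j\<in>?J. f (b j))" for f :: "'b multiset \<Rightarrow> real" and c
    using assms by (auto intro!: prod.cong)
  define U where "U = (\<Prod>j\<in>Q. ch (add_mset x t) (b j))"
  define T where "T = (\<Prod>j\<in>?J. ch t (b j))"
  have "ch (add_mset x t) (b i) = ch t (b i) + 1 / sqrt lam * (\<Sum>h\<in>#b i. F h x * ch t (b i - {#h#}))"
    by (simp add: ch_def charlier_add_left)
  then show ?thesis
    unfolding z mixed_def J(1) prod.insert[OF fin(2) J(2)] prod.insert[OF fin(1) assms(3)] split upd
      U_def[symmetric] T_def[symmetric]
    by (simp add: algebra_simps sum_mset_distrib_left sum_mset_distrib_right)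
qed

lemma mixed_empty:
  assumes "gs \<in> msets B" "(\<lambda>t. prob t * (\<Prod>i\<in>I. ch t (b i))) summable_on msets A"
  shows "(mixed I gs {} b has_sum mom gs * moment I b) (A \<times> msets A)"
  using has_sum_mult_product[OF has_sum_infsum[OF moments_summable[OF assms(1)]] has_sum_infsum[OF assms(2)]]
  by (simp add: mixed_def mom_def moment_def)

text \<open>Expanding the factors of Q one at a time moves labels from b to gs and never increases
  \<open>total\<close>, so the hypothesis on moments still applies when Q is exhausted. There the
  integrand is a product of a function of x and a function of t.\<close>

lemma mixed_summable_aux:
  assumes fin: "finite I"
    and IH: "\<And>b. \<forall>i\<in>I. b i \<in> msets B \<Longrightarrow> total I b \<le> n \<Longrightarrow>
          (\<lambda>t. prob t * (\<Prod>i\<in>I. ch t (b i))) summable_on msets A"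
    and Q: "Q \<subseteq> I" and "gs \<in> msets B" "\<forall>i\<in>I. b i \<in> msets B" "total I b \<le> n"
  shows "mixed I gs Q b summable_on A \<times> msets A"
  using finite_subset[OF Q fin] assms(3-)
proof (induction Q arbitrary: gs b rule: finite_induct)
  case empty
  then show ?case using mixed_empty[OF _ IH] has_sum_imp_summable by blast
next
  case (insert i Q)
  have "mixed I (add_mset h gs) Q (b(i := b i - {#h#})) summable_on A \<times> msets A" if "h \<in># b i" for h
    using insert.prems that
    by (intro insert.IH order.trans[OF total_remove_le[OF fin]]) (auto dest: msets_member)
  then have "((\<lambda>z. \<Sum>h\<in>#b i. mixed I (add_mset h gs) Q (b(i := b i - {#h#})) z) has_sum
      (\<Sum>h\<in>#b i. mixed_moment I (add_mset h gs) Q (b(i := b i - {#h#})))) (A \<times> msets A)"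
    unfolding mixed_moment_def by (intro has_sum_sum_mset has_sum_infsum)
  moreover have "mixed I gs Q b summable_on A \<times> msets A"
    using insert.prems by (intro insert.IH) auto
  ultimately have "(\<lambda>z. mixed I gs Q b z + 1 / sqrt lam *
      (\<Sum>h\<in>#b i. mixed I (add_mset h gs) Q (b(i := b i - {#h#})) z)) summable_on A \<times> msets A"
    by (intro summable_on_add summable_on_cmult_right) (auto dest: has_sum_imp_summable)
  moreover have "mixed I gs (insert i Q) b z = mixed I gs Q b z + 1 / sqrt lam *
      (\<Sum>h\<in>#b i. mixed I (add_mset h gs) Q (b(i := b i - {#h#})) z)" for z
    using insert by (intro mixed_insert fin) auto
  ultimately show ?case by (simp add: fun_eq_iff cong: summable_on_cong)
qed

text \<open>Take the label g off factor i by \<open>charlier_add_right\<close>. In the resulting sum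
  over x in t, factor i sees t without x and the others see t, so after Mecke's formula the others
  see the enlarged multiset. The factor sqrt lam is lam / sqrt lam.\<close>

lemma moment_step:
  assumes fin: "finite I" and i: "i \<in> I"
    and s1: "(\<lambda>t. prob t * (\<Prod>j\<in>I. ch t ((b(i := c)) j))) summable_on msets A"
    and s2: "mixed I {#g#} (I - {i}) (b(i := c)) summable_on A \<times> msets A"
  shows "((\<lambda>t. prob t * (\<Prod>j\<in>I. ch t ((b(i := add_mset g c)) j))) has_sum
     mean g * moment I (b(i := c)) + sqrt lam * mixed_moment I {#g#} (I - {i}) (b(i := c))) (msets A)"
proof -
  define R where "R t = (\<Prod>j\<in>I - {i}. ch t (b j))" for t
  have R: "(\<Prod>j\<in>I. ch t ((b(i := d)) j)) = ch t d * R t" for t d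
    using fin i by (subst prod.remove[of I i]) (auto simp: R_def intro!: prod.cong)
  have R': "(\<Prod>j\<in>I - {i}. ch t ((b(i := d)) j)) = R t" for t d
    by (auto simp: R_def intro!: prod.cong)
  have "I - (I - {i}) = {i}" using i by auto
  then have "((\<lambda>(x, t). p x * prob t * (F g x * ch t c * R (add_mset x t))) has_sum
      mixed_moment I {#g#} (I - {i}) (b(i := c))) (A \<times> msets A)"
    using has_sum_infsum[OF s2] unfolding mixed_moment_def mixed_def R' by (simp add: mult_ac)
  from prob_mecke[OF this]
  have "((\<lambda>t. prob t * (\<Sum>x\<in>#t. F g x * ch (t - {#x#}) c * R t)) has_sum
      lam * mixed_moment I {#g#} (I - {i}) (b(i := c))) (msets A)"
    by (rule has_sum_cong[THEN iffD1, rotated])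
       (auto intro!: arg_cong[where f = sum_mset] image_mset_cong)
  then have "((\<lambda>t. mean g * (prob t * (ch t c * R t)) +
      1 / sqrt lam * (prob t * (\<Sum>x\<in>#t. F g x * ch (t - {#x#}) c * R t))) has_sum
      mean g * moment I (b(i := c)) +
      1 / sqrt lam * (lam * mixed_moment I {#g#} (I - {i}) (b(i := c)))) (msets A)"
    using has_sum_infsum[OF s1] unfolding moment_def R
    by (intro has_sum_add has_sum_cmult_right)
  moreover have "mean g * (prob t * (ch t c * R t)) +
      1 / sqrt lam * (prob t * (\<Sum>x\<in>#t. F g x * ch (t - {#x#}) c * R t)) =
      prob t * (ch t (add_mset g c) * R t)" for t
    by (simp add: ch_def charlier_add_right algebra_simps sum_mset_distrib_left)
  moreover have "1 / sqrt lam * (lam * v) = sqrt lam * v" for v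
    using lam_pos by (simp add: field_simps real_sqrt_mult_self flip: mult.assoc)
  ultimately show ?thesis unfolding R by simp
qed

text \<open>Induction on the number of labels: \<open>moment_step\<close> consumes one, and
  \<open>mixed_summable_aux\<close> supplies its summability premise.\<close>

lemma moment_summable_le:
  assumes "finite I"
  shows "\<forall>i\<in>I. b i \<in> msets B \<Longrightarrow> total I b \<le> n \<Longrightarrow>
     (\<lambda>t. prob t * (\<Prod>i\<in>I. ch t (b i))) summable_on msets A"
proof (induction n arbitrary: b)
  case 0
  then have "\<forall>i\<in>I. b i = {#}" using assms by (auto simp: total_def)
  then have "(\<Prod>i\<in>I. ch t (b i)) = 1" for t by (intro prod.neutral) (auto simp: ch_def)
  then show ?case using has_sum_imp_summable[OF prob_sum] by simp
next
  case (Suc n)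
  show ?case
  proof (cases "total I b = 0")
    case True
    then show ?thesis using Suc by simp
  next
    case False
    from nonempty_family_split[OF assms Suc.prems(1) False]
    obtain i g c where *: "i \<in> I" "g \<in> B" "c \<in> msets B" "b i = add_mset g c"
      "\<forall>j\<in>I. (b(i := c)) j \<in> msets B" "total I b = Suc (total I (b(i := c)))" by blast
    then have le: "total I (b(i := c)) \<le> n" using Suc.prems by simp
    have "mixed I {#g#} (I - {i}) (b(i := c)) summable_on A \<times> msets A"
      by (rule mixed_summable_aux[OF assms Suc.IH]) (use * le in auto)
    from has_sum_imp_summable[OF moment_step[OF assms \<open>i \<in> I\<close> Suc.IH[OF *(5) le] this]]
    show ?thesis unfolding *(4)[symmetric] fun_upd_triv .
  qed
qed

context
  fixes I :: "'i set"
  assumes fin: "finite I"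
begin

lemma moment_summable:
  "\<forall>i\<in>I. b i \<in> msets B \<Longrightarrow> (\<lambda>t. prob t * (\<Prod>i\<in>I. ch t (b i))) summable_on msets A"
  using moment_summable_le[OF fin] by blast

lemma mixed_summable:
  assumes "Q \<subseteq> I" "gs \<in> msets B" "\<forall>i\<in>I. b i \<in> msets B"
  shows "mixed I gs Q b summable_on A \<times> msets A"
  by (rule mixed_summable_aux[OF fin moment_summable_le[OF fin] assms order.refl])

lemma mixed_moment_empty:
  assumes "gs \<in> msets B" "\<forall>i\<in>I. b i \<in> msets B"
  shows "mixed_moment I gs {} b = mom gs * moment I b"
  unfolding mixed_moment_def
  by (intro infsumI mixed_empty moment_summable assms)

lemma mixed_moment_insert:
  assumes "i \<in> I" "i \<notin> Q" "Q \<subseteq> I" "gs \<in> msets B" "\<forall>i\<in>I. b i \<in> msets B"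
  shows "mixed_moment I gs (insert i Q) b = mixed_moment I gs Q b +
    1 / sqrt lam * (\<Sum>h\<in>#b i. mixed_moment I (add_mset h gs) Q (b(i := b i - {#h#})))"
  unfolding mixed_moment_def mixed_insert[OF fin assms(1-3)]
  using assms by (intro infsumI has_sum_add has_sum_cmult_right has_sum_sum_mset has_sum_infsum mixed_summable)
     (auto dest: msets_member)

lemma moment_empty:
  assumes "\<forall>i\<in>I. b i = {#}"
  shows "moment I b = 1"
proof -
  have "(\<Prod>i\<in>I. ch t (b i)) = 1" for t using assms by (intro prod.neutral) (auto simp: ch_def)
  then show ?thesis using infsumI[OF prob_sum] by (simp add: moment_def)
qed

lemma moment_add:
  assumes "i \<in> I" "\<forall>i\<in>I. b i \<in> msets B" "g \<in> B" "c \<in> msets B"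
  shows "moment I (b(i := add_mset g c)) =
    mean g * moment I (b(i := c)) + sqrt lam * mixed_moment I {#g#} (I - {i}) (b(i := c))"
  unfolding moment_def[of I "b(i := add_mset g c)"]
  using assms by (intro infsumI moment_step fin moment_summable mixed_summable) auto

end

text \<open>With two factors, removing g from the first leaves one factor to expand. The term in
  which it ignores x cancels against \<open>mean\<close>; the others contract g with a label h and
  vanish unless h = g. What remains is the recursion of \<open>mfact b\<close> on the
  diagonal.\<close>

lemma moment_pair:
  assumes "b \<in> msets B" "b' \<in> msets B"
  shows "((\<lambda>t. prob t * ch t b * ch t b') has_sum (if b = b' then mfact b else 0)) (msets A)"
proof -
  let ?I = "{True, False}"
  define M where "M b b' = moment ?I (\<lambda>i. if i then b else b')" for b b'
  have upd: "(\<lambda>i. if i then b else b')(True := c) = (\<lambda>i. if i then c else b')"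
    "(\<lambda>i. if i then b else b')(False := c) = (\<lambda>i. if i then b else c)" for b b' c :: "'b multiset"
    by auto
  have D: "?I - {True} = insert False {}" by auto
  have step: "M (add_mset g b) b' = real (count b' g) * M b (b' - {#g#})"
    if "g \<in> B" "b \<in> msets B" "b' \<in> msets B" for g b b'
  proof -
    have "M (add_mset g b) b' = mean g * M b b' + sqrt lam * mixed_moment ?I {#g#} (insert False {}) (\<lambda>i. if i then b else b')"
      using moment_add[of ?I True "\<lambda>i. if i then b else b'" g b] that by (simp add: M_def upd D)
    also have "mixed_moment ?I {#g#} (insert False {}) (\<lambda>i. if i then b else b') =
        mom {#g#} * M b b' + 1 / sqrt lam * (\<Sum>h\<in>#b'. mom {#h, g#} * M b (b' - {#h#}))"
      using that
      by (subst mixed_moment_insert)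
         (auto simp: mixed_moment_empty upd M_def dest: msets_member
            intro!: arg_cong[where f = sum_mset] image_mset_cong mixed_moment_empty)
    also have "(\<Sum>h\<in>#b'. mom {#h, g#} * M b (b' - {#h#})) =
        (\<Sum>h\<in>#b'. if h = g then M b (b' - {#g#}) else 0)"
      using that by (intro arg_cong[where f = sum_mset] image_mset_cong) (auto simp: mom_pair dest: msets_member)
    also have "\<dots> = real (count b' g) * M b (b' - {#g#})"
      by (simp add: sum_mset_delta)
    finally show ?thesis
      using that lam_pos by (simp add: mom_single mean_def distrib_left)
  qed
  have "M b b' = (if b = b' then mfact b else 0)"
    using assms
  proof (induction b arbitrary: b')
    case empty
    show ?case
    proof (cases b')
      case empty
      then show ?thesis by (simp add: M_def moment_empty)
    next
      \<comment> \<open>The recursion removes labels from the first index only, so the roles of the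
        two are exchanged by symmetry.\<close>
      case (add g c)
      have "M {#} b' = M b' {#}"
        by (simp add: M_def moment_def mult_ac)
      then show ?thesis using step[of g c "{#}"] empty add by simp
    qed
  next
    case (add g b)
    show ?case
    proof (cases "g \<in># b'")
      case True
      then obtain c where c: "b' = add_mset g c" by (meson multi_member_split)
      then show ?thesis using step[of g b b'] add by (auto simp: mfact_add_mset)
    next
      case False
      then show ?thesis using step[of g b b'] add by (auto simp: not_in_iff)
    qed
  qed
  moreover have "((\<lambda>t. prob t * (\<Prod>i\<in>?I. ch t (if i then b else b'))) has_sum M b b') (msets A)"
    unfolding M_def moment_def by (intro has_sum_infsum moment_summable) (use assms in auto)
  ultimately show ?thesis by (simp add: mult_ac)
qed

end

section \<open>Limits of the moments as lam tends to infinity\<close>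

lemma tendsto_sum_mset:
  fixes f :: "'b \<Rightarrow> 'a \<Rightarrow> real"
  assumes "\<And>y. y \<in># M \<Longrightarrow> (f y \<longlongrightarrow> v y) G"
  shows "((\<lambda>x. \<Sum>y\<in>#M. f y x) \<longlongrightarrow> (\<Sum>y\<in>#M. v y)) G"
  using assms by (induction M) (auto intro!: tendsto_add)

lemma inverse_sqrt_tendsto_0: "((\<lambda>x :: real. 1 / sqrt x) \<longlongrightarrow> 0) at_top"
  using tendsto_inverse_0_at_top[OF sqrt_at_top] by (simp add: divide_inverse)

context
  fixes p :: "real \<Rightarrow> 'a \<Rightarrow> real" and A :: "'a set"
    and F :: "real \<Rightarrow> 'b \<Rightarrow> 'a \<Rightarrow> real" and B :: "'b set" and g0 :: 'b and I :: "'i set"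
  assumes pc: "\<And>lam. lam > 0 \<Longrightarrow> poisson_charlier lam (p lam) A (F lam) B g0"
    and fin: "finite I"
    and mom_conv: "\<And>gs. gs \<in> msets B \<Longrightarrow>
          \<exists>v. ((\<lambda>lam. poisson_charlier.mom (p lam) A (F lam) gs) \<longlongrightarrow> v) at_top"
begin

abbreviation "mom_at lam \<equiv> poisson_charlier.mom (p lam) A (F lam)"
abbreviation "moment_at lam \<equiv> poisson_charlier.moment lam (p lam) A (F lam) g0 I"
abbreviation "mixed_at lam \<equiv> poisson_charlier.mixed_moment lam (p lam) A (F lam) g0 I"

text \<open>The weight of a contraction of k labels at one point: sqrt lam for k = 1, exactly 1 for
  k = 2, and tending to 0 for k at least 3.\<close>

definition scl :: "nat \<Rightarrow> real \<Rightarrow> real" where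
  "scl k lam = lam * (1 / sqrt lam) ^ k"

lemma scl_add2: "lam > 0 \<Longrightarrow> scl (k + 2) lam = (1 / sqrt lam) ^ k"
  by (simp add: scl_def power_add power2_eq_square field_simps)

lemma scl_Suc: "scl k lam * (1 / sqrt lam * v) = scl (Suc k) lam * v"
  by (simp add: scl_def)

lemma mixed_moment_scaled_insert:
  assumes "lam > 0" "i \<in> I" "i \<notin> Q" "Q \<subseteq> I" "gs \<in> msets B" "\<forall>i\<in>I. b i \<in> msets B"
  shows "scl k lam * mixed_at lam gs (insert i Q) b = scl k lam * mixed_at lam gs Q b +
    (\<Sum>h\<in>#b i. scl (Suc k) lam * mixed_at lam (add_mset h gs) Q (b(i := b i - {#h#})))"
  unfolding poisson_charlier.mixed_moment_insert[OF pc[OF assms(1)] fin assms(2-)] distrib_left scl_Suc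
  by (simp add: sum_mset_distrib_left)

context
  fixes T :: "('i \<Rightarrow> 'b multiset) \<Rightarrow> real" and n :: nat
  assumes IH: "\<And>b. \<forall>i\<in>I. b i \<in> msets B \<Longrightarrow> total I b \<le> n \<Longrightarrow> ((\<lambda>lam. moment_at lam b) \<longlongrightarrow> T b) at_top"
begin

text \<open>Further contractions only raise the exponent in \<open>scl\<close>. After all factors
  are expanded, a positive power of 1 / sqrt lam multiplies two convergent quantities: a moment of
  the previous depth and a moment with at most n labels.\<close>

lemma mixed_moment_tendsto_higher:
  assumes "Q \<subseteq> I" "gs \<in> msets B" "\<forall>i\<in>I. b i \<in> msets B" "total I b \<le> n" "size gs \<ge> 3"
  shows "((\<lambda>lam. scl (size gs) lam * mixed_at lam gs Q b) \<longlongrightarrow> 0) at_top"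
  using finite_subset[OF assms(1) fin] assms
proof (induction Q arbitrary: gs b rule: finite_induct)
  case empty
  obtain k where k: "size gs = Suc k + 2"
    using empty.prems by (metis add_2_eq_Suc' le_Suc_ex numeral_3_eq_3 add_Suc add.commute)
  obtain v where v: "((\<lambda>lam. mom_at lam gs) \<longlongrightarrow> v) at_top"
    using mom_conv empty.prems by blast
  have "((\<lambda>lam. (1 / sqrt lam) ^ Suc k * (mom_at lam gs * moment_at lam b)) \<longlongrightarrow> 0 * (v * T b)) at_top"
    using empty.prems by (intro tendsto_mult v IH tendsto_null_power inverse_sqrt_tendsto_0) auto
  moreover have "\<forall>\<^sub>F lam in at_top. (1 / sqrt lam) ^ Suc k * (mom_at lam gs * moment_at lam b) =
      scl (size gs) lam * mixed_at lam gs {} b"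
    using eventually_gt_at_top[of 0]
  proof eventually_elim
    case (elim lam)
    show ?case
      unfolding k scl_add2[OF elim]
      using poisson_charlier.mixed_moment_empty[OF pc[OF elim] fin empty.prems(2,3)] by simp
  qed
  ultimately show ?case by (simp add: tendsto_cong)
next
  case (insert i Q)
  have "((\<lambda>lam. scl (size gs) lam * mixed_at lam gs Q b +
      (\<Sum>h\<in>#b i. scl (size (add_mset h gs)) lam * mixed_at lam (add_mset h gs) Q (b(i := b i - {#h#})))) \<longlongrightarrow>
      0 + (\<Sum>h\<in>#b i. 0)) at_top"
    using insert.prems
    by (intro tendsto_add tendsto_sum_mset insert.IH order.trans[OF total_remove_le[OF fin]])
       (auto dest: msets_member)
  moreover have "\<forall>\<^sub>F lam in at_top. scl (size gs) lam * mixed_at lam gs Q b +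
      (\<Sum>h\<in>#b i. scl (size (add_mset h gs)) lam * mixed_at lam (add_mset h gs) Q (b(i := b i - {#h#}))) =
      scl (size gs) lam * mixed_at lam gs (insert i Q) b"
    using eventually_gt_at_top[of 0]
    by eventually_elim (use insert in \<open>auto simp: mixed_moment_scaled_insert\<close>)
  ultimately show ?case by (simp add: tendsto_cong)
qed

text \<open>The weight of two labels is 1 and their moment is a Kronecker delta by orthonormality.
  Every term in which a third label joins is covered by
  \<open>mixed_moment_tendsto_higher\<close>.\<close>

lemma mixed_moment_tendsto_pair:
  assumes "Q \<subseteq> I" "g \<in> B" "h \<in> B" "\<forall>i\<in>I. b i \<in> msets B" "total I b \<le> n"
  shows "((\<lambda>lam. scl 2 lam * mixed_at lam {#g, h#} Q b) \<longlongrightarrow> (if g = h then T b else 0)) at_top"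
  using finite_subset[OF assms(1) fin] assms
proof (induction Q rule: finite_induct)
  case empty
  have "((\<lambda>lam. (if g = h then 1 else 0) * moment_at lam b) \<longlongrightarrow> (if g = h then 1 else 0) * T b) at_top"
    using empty.prems by (intro tendsto_mult IH tendsto_const) auto
  moreover have "\<forall>\<^sub>F lam in at_top. (if g = h then 1 else 0) * moment_at lam b = scl 2 lam * mixed_at lam {#g, h#} {} b"
    using eventually_gt_at_top[of 0]
  proof eventually_elim
    case (elim lam)
    show ?case
      using poisson_charlier.mixed_moment_empty[OF pc[OF elim] fin, of "{#g, h#}" b]
        poisson_charlier.mom_pair[OF pc[OF elim], of g h] scl_add2[OF elim, of 0] empty.prems
      by (simp add: numeral_2_eq_2)
  qed
  ultimately have "((\<lambda>lam. scl 2 lam * mixed_at lam {#g, h#} {} b) \<longlongrightarrow> (if g = h then 1 else 0) * T b) at_top"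
    by (rule Lim_transform_eventually)
  then show ?case by (cases "g = h") simp_all
next
  case (insert i Q)
  have "((\<lambda>lam. scl 2 lam * mixed_at lam {#g, h#} Q b +
      (\<Sum>k\<in>#b i. scl (size {#k, g, h#}) lam * mixed_at lam {#k, g, h#} Q (b(i := b i - {#k#})))) \<longlongrightarrow>
      (if g = h then T b else 0) + (\<Sum>k\<in>#b i. 0)) at_top"
    using insert.prems
    by (intro tendsto_add tendsto_sum_mset insert.IH mixed_moment_tendsto_higher order.trans[OF total_remove_le[OF fin]])
       (auto dest: msets_member)
  moreover have "\<forall>\<^sub>F lam in at_top. scl 2 lam * mixed_at lam {#g, h#} Q b +
      (\<Sum>k\<in>#b i. scl (size {#k, g, h#}) lam * mixed_at lam {#k, g, h#} Q (b(i := b i - {#k#}))) =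
      scl 2 lam * mixed_at lam {#g, h#} (insert i Q) b"
    using eventually_gt_at_top[of 0]
    by eventually_elim (use insert in \<open>auto simp: mixed_moment_scaled_insert numeral_3_eq_3 numeral_2_eq_2\<close>)
  ultimately show ?case by (simp add: tendsto_cong)
qed

text \<open>For g = g0 both summands carry a factor of order sqrt lam, so they are kept together:
  for empty Q they cancel exactly for each positive lam. Each factor j added to Q then contributes
  the pairings of g with an equal label of b j.\<close>

lemma mixed_moment_tendsto_single:
  assumes "Q \<subseteq> I" "g \<in> B" "\<forall>i\<in>I. b i \<in> msets B" "total I b \<le> n"
  shows "((\<lambda>lam. poisson_charlier.mean lam g0 g * moment_at lam b + scl 1 lam * mixed_at lam {#g#} Q b) \<longlongrightarrow>
     (\<Sum>j\<in>Q. real (count (b j) g) * T (b(j := b j - {#g#})))) at_top"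
  using finite_subset[OF assms(1) fin] assms
proof (induction Q rule: finite_induct)
  case empty
  have "\<forall>\<^sub>F lam in at_top. 0 = poisson_charlier.mean lam g0 g * moment_at lam b + scl 1 lam * mixed_at lam {#g#} {} b"
    using eventually_gt_at_top[of 0]
  proof eventually_elim
    case (elim lam)
    have "scl 1 lam = sqrt lam" using elim by (simp add: scl_def real_div_sqrt)
    then show ?case
      using poisson_charlier.mixed_moment_empty[OF pc[OF elim] fin, of "{#g#}" b]
        poisson_charlier.mom_single[OF pc[OF elim], of g] empty.prems
        poisson_charlier.mean_def[OF pc[OF elim], of g]
      by simp
  qed
  then have "((\<lambda>lam. poisson_charlier.mean lam g0 g * moment_at lam b + scl 1 lam * mixed_at lam {#g#} {} b) \<longlongrightarrow> 0) at_top"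
    using tendsto_cong tendsto_const by fastforce
  then show ?case by simp
next
  case (insert i Q)
  have "((\<lambda>lam. (poisson_charlier.mean lam g0 g * moment_at lam b + scl 1 lam * mixed_at lam {#g#} Q b) +
      (\<Sum>k\<in>#b i. scl 2 lam * mixed_at lam {#k, g#} Q (b(i := b i - {#k#})))) \<longlongrightarrow>
      (\<Sum>j\<in>Q. real (count (b j) g) * T (b(j := b j - {#g#}))) +
      (\<Sum>k\<in>#b i. if k = g then T (b(i := b i - {#k#})) else 0)) at_top"
    using insert.prems
    by (intro tendsto_add tendsto_sum_mset insert.IH mixed_moment_tendsto_pair order.trans[OF total_remove_le[OF fin]])
       (auto dest: msets_member)
  also have "(\<Sum>k\<in>#b i. if k = g then T (b(i := b i - {#k#})) else 0) =
      (\<Sum>k\<in>#b i. if k = g then T (b(i := b i - {#g#})) else 0)"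
    by (intro arg_cong[where f = sum_mset] image_mset_cong) auto
  also have "(\<Sum>j\<in>Q. real (count (b j) g) * T (b(j := b j - {#g#}))) + \<dots> =
      (\<Sum>j\<in>insert i Q. real (count (b j) g) * T (b(j := b j - {#g#})))"
    using insert.hyps by (simp add: sum_mset_delta)
  finally have "((\<lambda>lam. (poisson_charlier.mean lam g0 g * moment_at lam b + scl 1 lam * mixed_at lam {#g#} Q b) +
      (\<Sum>k\<in>#b i. scl 2 lam * mixed_at lam {#k, g#} Q (b(i := b i - {#k#})))) \<longlongrightarrow>
      (\<Sum>j\<in>insert i Q. real (count (b j) g) * T (b(j := b j - {#g#})))) at_top" .
  moreover have "\<forall>\<^sub>F lam in at_top. (poisson_charlier.mean lam g0 g * moment_at lam b + scl 1 lam * mixed_at lam {#g#} Q b) +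
      (\<Sum>k\<in>#b i. scl 2 lam * mixed_at lam {#k, g#} Q (b(i := b i - {#k#}))) =
      poisson_charlier.mean lam g0 g * moment_at lam b + scl 1 lam * mixed_at lam {#g#} (insert i Q) b"
    using eventually_gt_at_top[of 0]
    by eventually_elim (use insert in \<open>auto simp: mixed_moment_scaled_insert numeral_2_eq_2\<close>)
  ultimately show ?case by (rule Lim_transform_eventually)
qed

end

text \<open>The limit is characterised by a recursion alone: \<open>TS\<close> pairs the removed
  label of factor i with an equal label of another factor. The combinatorial formula for T enters
  only later.\<close>

lemma moment_tendsto_le:
  assumes T0: "\<And>b. \<forall>i\<in>I. b i = {#} \<Longrightarrow> T b = 1"
    and TS: "\<And>b i g c. i \<in> I \<Longrightarrow> b i = add_mset g c \<Longrightarrow>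
      T b = (\<Sum>j\<in>I - {i}. real (count (b j) g) * T (b(i := c, j := b j - {#g#})))"
    and b: "\<forall>i\<in>I. b i \<in> msets B" "total I b \<le> n"
  shows "((\<lambda>lam. moment_at lam b) \<longlongrightarrow> T b) at_top"
proof -
  have zero: "((\<lambda>lam. moment_at lam b) \<longlongrightarrow> T b) at_top" if "total I b = 0" for b
  proof -
    have *: "\<forall>i\<in>I. b i = {#}" using that fin by (auto simp: total_def)
    have "\<forall>\<^sub>F lam in at_top. T b = moment_at lam b"
      using eventually_gt_at_top[of 0]
      by eventually_elim (use poisson_charlier.moment_empty[OF pc fin *] T0[OF *] in auto)
    then show ?thesis using tendsto_cong tendsto_const by fastforce
  qed
  show ?thesis using b
  proof (induction n arbitrary: b)
    case 0
    then show ?case using zero by simp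
  next
    case (Suc n)
    show ?case
    proof (cases "total I b = 0")
      case True
      then show ?thesis by (rule zero)
    next
      case False
      from nonempty_family_split[OF fin Suc.prems(1) False]
      obtain i g c where *: "i \<in> I" "g \<in> B" "c \<in> msets B" "b i = add_mset g c"
        "\<forall>j\<in>I. (b(i := c)) j \<in> msets B" "total I b = Suc (total I (b(i := c)))" by blast
      then have le: "total I (b(i := c)) \<le> n" using Suc.prems by simp
      have "((\<lambda>lam. poisson_charlier.mean lam g0 g * moment_at lam (b(i := c)) + scl 1 lam * mixed_at lam {#g#} (I - {i}) (b(i := c))) \<longlongrightarrow>
          (\<Sum>j\<in>I - {i}. real (count ((b(i := c)) j) g) * T (b(i := c, j := (b(i := c)) j - {#g#})))) at_top"
        by (rule mixed_moment_tendsto_single[OF Suc.IH]) (use * le in auto)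
      also have "(\<Sum>j\<in>I - {i}. real (count ((b(i := c)) j) g) * T (b(i := c, j := (b(i := c)) j - {#g#}))) = T b"
        unfolding TS[where b = b, OF *(1,4)] by (intro sum.cong) auto
      finally have lim: "((\<lambda>lam. poisson_charlier.mean lam g0 g * moment_at lam (b(i := c)) +
          scl 1 lam * mixed_at lam {#g#} (I - {i}) (b(i := c))) \<longlongrightarrow> T b) at_top" .
      have "\<forall>\<^sub>F lam in at_top. poisson_charlier.mean lam g0 g * moment_at lam (b(i := c)) +
          scl 1 lam * mixed_at lam {#g#} (I - {i}) (b(i := c)) = moment_at lam b"
        using eventually_gt_at_top[of 0]
      proof eventually_elim
        case (elim lam)
        have "scl 1 lam = sqrt lam" using elim by (simp add: scl_def real_div_sqrt)
        then show ?case
          using poisson_charlier.moment_add[OF pc[OF elim] fin *(1) Suc.prems(1) *(2,3)]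
          unfolding *(4)[symmetric] fun_upd_triv by simp
      qed
      with lim show ?thesis by (rule Lim_transform_eventually)
    qed
  qed
qed

end

lemmas moment_tendsto = moment_tendsto_le[OF _ _ _ _ _ _ order.refl]

section \<open>Coefficients of the exponential of the pair sum\<close>

text \<open>Multiplication by the variable x_i, on coefficient functions.\<close>

definition shift :: "nat \<Rightarrow> mps \<Rightarrow> mps" where
  "shift i f m = (if m i = 0 then 0 else f (m(i := m i - 1)))"

lemma shift_commute: "shift i (shift j f) = shift j (shift i f)"
  by (auto simp: shift_def fun_eq_iff fun_upd_twist)

lemma shift_sum: "shift i (\<lambda>m. \<Sum>x\<in>S. f x m) m = (\<Sum>x\<in>S. shift i (f x) m)"
  by (simp add: shift_def)

lemma shift_zero [simp]: "shift i (\<lambda>m. 0) = (\<lambda>m. 0)"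
  by (simp add: shift_def fun_eq_iff)

lemma shift_cmult: "shift i (\<lambda>m. c * f m) = (\<lambda>m. c * shift i f m)"
  by (simp add: shift_def fun_eq_iff)

lemma shift_degree: "real (m i) * shift j f m = shift j (\<lambda>m. real (m i) * f m) m + (if i = j then shift j f m else 0)"
  by (auto simp: shift_def algebra_simps of_nat_diff)

text \<open>For an exponent vector of infinite support the sum in \<open>mps_mult\<close> ranges
  over an infinite set and is 0 by convention, so identities between products and shifts are claimed
  for finite support only.\<close>

definition finsupp :: "(nat \<Rightarrow> nat) \<Rightarrow> bool" where
  "finsupp m \<longleftrightarrow> finite {i. m i \<noteq> 0}"

lemma finsupp_upd [simp]: "finsupp m \<Longrightarrow> finsupp (m(i := k))"
  unfolding finsupp_def by (rule finite_subset[of _ "insert i {i. m i \<noteq> 0}"]) auto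

lemma finsupp_finite_le:
  assumes "finsupp m"
  shows "finite {a :: nat \<Rightarrow> nat. \<forall>i. a i \<le> m i}"
proof -
  have "finite (Pi\<^sub>E {i. m i \<noteq> 0} (\<lambda>i. {..m i}))"
    using assms by (intro finite_PiE) (auto simp: finsupp_def)
  moreover have "{a. \<forall>i. a i \<le> m i} \<subseteq> (\<lambda>a i. if m i \<noteq> 0 then a i else 0) ` Pi\<^sub>E {i. m i \<noteq> 0} (\<lambda>i. {..m i})"
  proof
    fix a assume a: "a \<in> {a. \<forall>i. a i \<le> m i}"
    then have "a = (\<lambda>i. if m i \<noteq> 0 then restrict a {i. m i \<noteq> 0} i else 0)"
      by (auto simp: fun_eq_iff) (metis le_zero_eq)
    moreover have "restrict a {i. m i \<noteq> 0} \<in> Pi\<^sub>E {i. m i \<noteq> 0} (\<lambda>i. {..m i})"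
      using a by auto
    ultimately show "a \<in> (\<lambda>a i. if m i \<noteq> 0 then a i else 0) ` Pi\<^sub>E {i. m i \<noteq> 0} (\<lambda>i. {..m i})"
      by blast
  qed
  ultimately show ?thesis using finite_surj by blast
qed

lemma mps_mult_X:
  assumes "finsupp m"
  shows "mps_mult (mps_X i) f m = shift i f m"
proof -
  let ?e = "\<lambda>j. if j = i then 1 else 0 :: nat"
  have "mps_mult (mps_X i) f m = (\<Sum>a\<in>{a. \<forall>i. a i \<le> m i}. if a = ?e then f (\<lambda>i. m i - a i) else 0)"
    unfolding mps_mult_def by (intro sum.cong) (auto simp: mps_X_def)
  also have "\<dots> = (if \<forall>j. ?e j \<le> m j then f (\<lambda>j. m j - ?e j) else 0)"
    using finsupp_finite_le[OF assms] by (subst sum.delta) auto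
  also have "(\<lambda>j. m j - ?e j) = m(i := m i - 1)" by auto
  also have "(\<forall>j. ?e j \<le> m j) \<longleftrightarrow> m i \<noteq> 0" by auto
  finally show ?thesis by (auto simp: shift_def)
qed

lemma mps_mult_XX:
  assumes "finsupp m" "i \<noteq> j"
  shows "mps_mult (mps_mult (mps_X i) (mps_X j)) f m = shift i (shift j f) m"
proof -
  let ?e = "\<lambda>k. if k = i \<or> k = j then 1 else 0 :: nat"
  have XX: "mps_mult (mps_X i) (mps_X j) a = (if a = ?e then 1 else 0)" if "finsupp a" for a
  proof -
    have "a(i := a i - 1) = (\<lambda>k. if k = j then 1 else 0) \<and> a i \<noteq> 0 \<longleftrightarrow> a = ?e"
      using assms(2)
      by (auto simp: fun_eq_iff split: if_splits)
    then show ?thesis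
      using mps_mult_X[OF that, of i "mps_X j"] by (auto simp: shift_def mps_X_def[of j])
  qed
  have fs: "finsupp a" if "\<forall>i. a i \<le> m i" for a
  proof -
    have "{i. a i \<noteq> 0} \<subseteq> {i. m i \<noteq> 0}" using that by (auto intro: less_le_trans)
    then show ?thesis using assms(1) finite_subset by (auto simp: finsupp_def)
  qed
  have "mps_mult (mps_mult (mps_X i) (mps_X j)) f m =
      (\<Sum>a\<in>{a. \<forall>i. a i \<le> m i}. if a = ?e then f (\<lambda>i. m i - a i) else 0)"
    unfolding mps_mult_def[of _ f] by (intro sum.cong) (auto simp: XX fs)
  also have "\<dots> = (if \<forall>j. ?e j \<le> m j then f (\<lambda>j. m j - ?e j) else 0)"
    using finsupp_finite_le[OF assms(1)] by (subst sum.delta) auto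
  also have "(\<lambda>k. m k - ?e k) = m(i := m i - 1, j := m j - 1)" by auto
  also have "(\<forall>j. ?e j \<le> m j) \<longleftrightarrow> m i \<noteq> 0 \<and> m j \<noteq> 0" using assms(2) by auto
  finally show ?thesis using assms(2) by (auto simp: shift_def)
qed

definition pairs :: "nat \<Rightarrow> (nat \<times> nat) set" where
  "pairs n = {(i, j). 1 \<le> i \<and> i < j \<and> j \<le> n}"

lemma finite_pairs: "finite (pairs n)"
  by (rule finite_subset[of _ "{1..n} \<times> {1..n}"]) (auto simp: pairs_def)

lemma mps_mult_pair_sum:
  assumes "finsupp m"
  shows "mps_mult (pair_sum n) f m = (\<Sum>(i, j)\<in>pairs n. shift i (shift j f) m)"
proof -
  have "mps_mult (pair_sum n) f m =
      (\<Sum>p\<in>pairs n. mps_mult (mps_mult (mps_X (fst p)) (mps_X (snd p))) f m)"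
    unfolding mps_mult_def[of _ f] pair_sum_def pairs_def[symmetric] sum_distrib_right
    by (rule sum.swap)
  also have "\<dots> = (\<Sum>(i, j)\<in>pairs n. shift i (shift j f) m)"
    using assms by (intro sum.cong) (auto simp: mps_mult_XX pairs_def)
  finally show ?thesis .
qed

text \<open>Agrees with the powers of \<open>pair_sum n\<close> on exponents of finite support.
  Being built from shifts, it satisfies the derivative identity for all exponents, without side
  conditions.\<close>

fun pair_pow :: "nat \<Rightarrow> nat \<Rightarrow> mps" where
  "pair_pow n 0 = mps_one"
| "pair_pow n (Suc k) = (\<lambda>m. \<Sum>(i, j)\<in>pairs n. shift i (shift j (pair_pow n k)) m)"

lemma shift_cong_finsupp:
  assumes "finsupp m" "\<And>m. finsupp m \<Longrightarrow> f m = g m"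
  shows "shift i f m = shift i g m"
  using assms by (auto simp: shift_def)

lemma mps_pow_pair_sum: "finsupp m \<Longrightarrow> mps_pow (pair_sum n) k m = pair_pow n k m"
proof (induction k arbitrary: m)
  case (Suc k)
  have "shift i (shift j (mps_pow (pair_sum n) k)) m = shift i (shift j (pair_pow n k)) m" for i j
    using Suc by (intro shift_cong_finsupp) auto
  then show ?case using Suc.prems by (simp add: mps_mult_pair_sum)
qed simp

text \<open>Each j other than i lies together with i in exactly one ordered pair, and symmetry of f
  makes the order irrelevant.\<close>

lemma sum_pairs_containing:
  fixes f :: "nat \<Rightarrow> nat \<Rightarrow> real"
  assumes "i \<in> {1..n}" "\<And>a b. f a b = f b a"
  shows "(\<Sum>(a, b)\<in>pairs n. (if i = a then f a b else 0) + (if i = b then f a b else 0)) =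
         (\<Sum>j\<in>{1..n} - {i}. f i j)"
proof -
  have "(\<Sum>p\<in>pairs n. if i = fst p then f (fst p) (snd p) else 0) =
      (\<Sum>p\<in>{p \<in> pairs n. i = fst p}. f (fst p) (snd p))"
    by (rule sum.inter_filter[symmetric, OF finite_pairs])
  also have "\<dots> = (\<Sum>j\<in>{i<..n}. f i j)"
    by (rule sum.reindex_bij_witness[where i = "\<lambda>j. (i, j)" and j = snd])
       (use assms(1) in \<open>auto simp: pairs_def\<close>)
  finally have 1: "(\<Sum>p\<in>pairs n. if i = fst p then f (fst p) (snd p) else 0) = (\<Sum>j\<in>{i<..n}. f i j)" .
  have "(\<Sum>p\<in>pairs n. if i = snd p then f (fst p) (snd p) else 0) =
      (\<Sum>p\<in>{p \<in> pairs n. i = snd p}. f (fst p) (snd p))"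
    by (rule sum.inter_filter[symmetric, OF finite_pairs])
  also have "\<dots> = (\<Sum>j\<in>{1..<i}. f j i)"
    by (rule sum.reindex_bij_witness[where i = "\<lambda>j. (j, i)" and j = fst])
       (use assms(1) in \<open>auto simp: pairs_def\<close>)
  also have "\<dots> = (\<Sum>j\<in>{1..<i}. f i j)"
    by (intro sum.cong refl assms(2))
  finally have 2: "(\<Sum>p\<in>pairs n. if i = snd p then f (fst p) (snd p) else 0) = (\<Sum>j\<in>{1..<i}. f i j)" .
  have split: "{1..n} - {i} = {1..<i} \<union> {i<..n}" using assms(1) by auto
  have "(\<Sum>j\<in>{1..n} - {i}. f i j) = (\<Sum>j\<in>{1..<i}. f i j) + (\<Sum>j\<in>{i<..n}. f i j)"
    unfolding split by (rule sum.union_disjoint) auto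
  with 1 2 show ?thesis
    by (simp add: case_prod_unfold sum.distrib)
qed

text \<open>The i-th derivative of the k-th power of the pair sum f is k f^(k-1) times the i-th
  derivative of f, both sides multiplied by x_i.\<close>

lemma pair_pow_degree:
  assumes "i \<in> {1..n}"
  shows "real (m i) * pair_pow n (Suc k) m = real (Suc k) * (\<Sum>j\<in>{1..n} - {i}. shift i (shift j (pair_pow n k)) m)"
proof -
  define D where "D g m = (\<Sum>j\<in>{1..n} - {i}. shift i (shift j g) m)" for g m
  \<comment> \<open>Multiplying the coefficient at m by m i is the Euler operator of x_i, a
    derivation: applied to x_a x_b g it leaves an extra copy of x_a x_b g when i is a or b. The
    surviving pairs sum to D g.\<close>
  have step: "real (m i) * (\<Sum>(a, b)\<in>pairs n. shift a (shift b g) m) =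
      (\<Sum>(a, b)\<in>pairs n. shift a (shift b (\<lambda>m. real (m i) * g m)) m) + D g m" for g m
  proof -
    have "real (m i) * shift a (shift b g) m = shift a (shift b (\<lambda>m. real (m i) * g m)) m +
        ((if i = a then shift a (shift b g) m else 0) + (if i = b then shift a (shift b g) m else 0))" for a b
      unfolding shift_degree[of m i a] by (auto simp: shift_degree shift_def algebra_simps of_nat_diff)
    then have "real (m i) * (\<Sum>(a, b)\<in>pairs n. shift a (shift b g) m) =
        (\<Sum>(a, b)\<in>pairs n. shift a (shift b (\<lambda>m. real (m i) * g m)) m) +
        (\<Sum>(a, b)\<in>pairs n. (if i = a then shift a (shift b g) m else 0) + (if i = b then shift a (shift b g) m else 0))"
      by (simp add: sum_distrib_left case_prod_unfold sum.distrib)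
    then show ?thesis
      using sum_pairs_containing[OF assms, of "\<lambda>a b. shift a (shift b g) m"]
      by (simp add: D_def shift_commute)
  qed
  \<comment> \<open>D and the sum over pairs are both multiplications by polynomials, hence
    commute.\<close>
  have swap: "(\<Sum>(a, b)\<in>pairs n. shift a (shift b (D g)) m) = D (\<lambda>m. \<Sum>(a, b)\<in>pairs n. shift a (shift b g) m) m" for g m
  proof -
    have "shift b (D g) = (\<lambda>m. \<Sum>j\<in>{1..n} - {i}. shift b (shift i (shift j g)) m)" for b g
      by (simp add: D_def[abs_def] fun_eq_iff shift_sum)
    then have "shift a (shift b (D g)) m = (\<Sum>j\<in>{1..n} - {i}. shift a (shift b (shift i (shift j g))) m)" for a b
      by (simp add: shift_sum)
    moreover have "shift j (\<lambda>m. \<Sum>(a, b)\<in>pairs n. shift a (shift b g) m) =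
        (\<lambda>m. \<Sum>(a, b)\<in>pairs n. shift j (shift a (shift b g)) m)" for j
      by (simp add: fun_eq_iff shift_sum case_prod_unfold)
    then have "shift i (shift j (\<lambda>m. \<Sum>(a, b)\<in>pairs n. shift a (shift b g) m)) m =
        (\<Sum>(a, b)\<in>pairs n. shift i (shift j (shift a (shift b g))) m)" for j
      by (simp add: shift_sum case_prod_unfold)
    moreover have "shift a (shift b (shift i (shift j g))) = shift i (shift j (shift a (shift b g)))" for a b j
      by (metis shift_commute)
    ultimately show ?thesis
      unfolding D_def case_prod_unfold by (simp add: sum.swap[of _ "pairs n"])
  qed
  have "real (m i) * pair_pow n (Suc k) m = real (Suc k) * D (pair_pow n k) m"
  proof (induction k arbitrary: m)
    case 0
    have "(\<lambda>m. real (m i) * mps_one m) = (\<lambda>m. 0)" by (auto simp: mps_one_def)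
    then show ?case using step[of m mps_one] by (simp add: case_prod_unfold)
  next
    case (Suc k)
    have "real (m i) * pair_pow n (Suc (Suc k)) m =
        (\<Sum>(a, b)\<in>pairs n. shift a (shift b (\<lambda>m. real (m i) * pair_pow n (Suc k) m)) m) + D (pair_pow n (Suc k)) m"
      using step[of m "pair_pow n (Suc k)"] by simp
    also have "(\<lambda>m. real (m i) * pair_pow n (Suc k) m) = (\<lambda>m. real (Suc k) * D (pair_pow n k) m)"
      using Suc by blast
    also have "(\<Sum>(a, b)\<in>pairs n. shift a (shift b (\<lambda>m. real (Suc k) * D (pair_pow n k) m)) m) =
        real (Suc k) * (\<Sum>(a, b)\<in>pairs n. shift a (shift b (D (pair_pow n k))) m)"
      by (simp only: shift_cmult case_prod_unfold sum_distrib_left)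
    also have "\<dots> = real (Suc k) * D (pair_pow n (Suc k)) m"
      unfolding swap by simp
    finally show ?case by (simp add: algebra_simps)
  qed
  then show ?thesis by (simp add: D_def)
qed

lemma mdeg_upd:
  assumes "finsupp m" "m i \<noteq> 0"
  shows "mdeg m = Suc (mdeg (m(i := m i - 1)))"
proof -
  have fin: "finite {i. m i \<noteq> 0}" using assms by (simp add: finsupp_def)
  have "mdeg m = m i + (\<Sum>j\<in>{i. m i \<noteq> 0} - {i}. m j)"
    unfolding mdeg_def using assms fin by (intro sum.remove) auto
  moreover have "mdeg (m(i := m i - 1)) = (\<Sum>j\<in>{i. m i \<noteq> 0}. (m(i := m i - 1)) j)"
    unfolding mdeg_def using fin by (intro sum.mono_neutral_left) (auto simp: assms)
  moreover have "\<dots> = (m i - 1) + (\<Sum>j\<in>{i. m i \<noteq> 0} - {i}. (m(i := m i - 1)) j)"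
    using assms fin by (subst sum.remove[where x = i]) auto
  moreover have "(\<Sum>j\<in>{i. m i \<noteq> 0} - {i}. (m(i := m i - 1)) j) = (\<Sum>j\<in>{i. m i \<noteq> 0} - {i}. m j)"
    by (intro sum.cong) auto
  ultimately show ?thesis using assms by simp
qed

text \<open>Each power lowers the degree by two; the cruder bound by one suffices to cut off the
  exponential series.\<close>

lemma pair_pow_eq_0: "finsupp m \<Longrightarrow> mdeg m < k \<Longrightarrow> pair_pow n k m = 0"
proof (induction k arbitrary: m)
  case (Suc k)
  have "shift j (pair_pow n k) m' = 0" if "finsupp m'" "mdeg m' \<le> k" for j m'
  proof (cases "m' j = 0")
    case False
    then have "mdeg (m'(j := m' j - 1)) < k" using that mdeg_upd[of m' j] by simp
    then have "pair_pow n k (m'(j := m' j - 1)) = 0" using Suc.IH finsupp_upd[OF that(1)] by blast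
    then show ?thesis by (simp add: shift_def)
  qed (simp add: shift_def)
  then have "shift i (shift j (pair_pow n k)) m = 0" for i j
    using Suc.prems mdeg_upd[of m i] by (cases "m i = 0") (simp_all add: shift_def[of i])
  then show ?case by (simp add: case_prod_unfold)
qed simp

text \<open>The cut-off K is free above the degree, so coefficients of different degrees can be
  compared under one common sum.\<close>

lemma mps_exp_pair_sum:
  assumes "finsupp m" "mdeg m \<le> K"
  shows "mps_exp (pair_sum n) m = (\<Sum>k\<le>K. pair_pow n k m / fact k)"
  unfolding mps_exp_def using assms
  by (intro sum.mono_neutral_cong_left) (auto simp: mps_pow_pair_sum pair_pow_eq_0)

lemma mps_exp_pair_sum_degree:
  assumes "finsupp m" "i \<in> {1..n}"
  shows "real (m i) * mps_exp (pair_sum n) m =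
    (\<Sum>j\<in>{1..n} - {i}. shift i (shift j (mps_exp (pair_sum n))) m)"
proof -
  define K where "K = mdeg m"
  have z: "real (m i) * pair_pow n 0 m = 0" by (auto simp: mps_one_def)
  \<comment> \<open>The upper limit Suc K leaves the range up to K after the vanishing term k = 0 is
    dropped and k is shifted.\<close>
  have "real (m i) * mps_exp (pair_sum n) m = (\<Sum>k\<le>Suc K. real (m i) * (pair_pow n k m / fact k))"
    using mps_exp_pair_sum[OF assms(1), of "Suc K" n] unfolding sum_distrib_left[symmetric]
    by (simp add: K_def)
  also have "\<dots> = (\<Sum>k\<le>K. real (m i) * (pair_pow n (Suc k) m / fact (Suc k)))"
    using z by (subst sum.atMost_Suc_shift) simp
  also have "\<dots> = (\<Sum>k\<le>K. (\<Sum>j\<in>{1..n} - {i}. shift i (shift j (pair_pow n k)) m / fact k))"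
  proof (intro sum.cong refl)
    fix k
    have "real (m i) * (pair_pow n (Suc k) m / fact (Suc k)) = (real (m i) * pair_pow n (Suc k) m) / fact (Suc k)"
      by simp
    also have "\<dots> = (\<Sum>j\<in>{1..n} - {i}. shift i (shift j (pair_pow n k)) m) / fact k"
      unfolding pair_pow_degree[OF assms(2)] by (simp del: of_nat_Suc)
    finally show "real (m i) * (pair_pow n (Suc k) m / fact (Suc k)) = (\<Sum>j\<in>{1..n} - {i}. shift i (shift j (pair_pow n k)) m / fact k)"
      by (simp add: sum_divide_distrib)
  qed
  also have "\<dots> = (\<Sum>j\<in>{1..n} - {i}. \<Sum>k\<le>K. shift i (shift j (pair_pow n k)) m / fact k)"
    by (rule sum.swap)
  also have "\<dots> = (\<Sum>j\<in>{1..n} - {i}. shift i (shift j (mps_exp (pair_sum n))) m)"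
  proof (intro sum.cong refl)
    fix j assume "j \<in> {1..n} - {i}"
    then have "j \<noteq> i" by auto
    show "(\<Sum>k\<le>K. shift i (shift j (pair_pow n k)) m / fact k) = shift i (shift j (mps_exp (pair_sum n))) m"
    proof (cases "m i = 0 \<or> m j = 0")
      case True
      then show ?thesis using \<open>j \<noteq> i\<close> by (auto simp: shift_def)
    next
      case False
      let ?m = "m(i := m i - 1, j := m j - 1)"
      have "mdeg m = Suc (mdeg (m(i := m i - 1)))" using False assms by (intro mdeg_upd) auto
      moreover have "mdeg (m(i := m i - 1)) = Suc (mdeg ?m)"
        using mdeg_upd[of "m(i := m i - 1)" j] False assms \<open>j \<noteq> i\<close> by simp
      ultimately have "mdeg ?m \<le> K" by (simp add: K_def)
      then show ?thesis using False \<open>j \<noteq> i\<close> assms(1) mps_exp_pair_sum[of ?m K n] by (simp add: shift_def)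
    qed
  qed
  finally show ?thesis .
qed

lemma mps_exp_zero: "mps_exp f (\<lambda>_. 0) = 1"
  by (simp add: mps_exp_def mdeg_def mps_one_def)

text \<open>For m supported in {1..n}, this counts the perfect matchings of n blocks with m i points
  each in which no pair lies inside a block; equivalently, the mean of a product of Hermite
  polynomials He_(m i) in one standard Gaussian.\<close>

definition wick :: "nat \<Rightarrow> (nat \<Rightarrow> nat) \<Rightarrow> real" where
  "wick n m = (\<Prod>i=1..n. fact (m i)) * mps_exp (pair_sum n) m"

lemma wick_zero [simp]: "wick n (\<lambda>_. 0) = 1"
  by (simp add: wick_def mps_exp_zero)

lemma fact_prod_remove:
  fixes m :: "nat \<Rightarrow> nat"
  assumes "i \<in> {1..n}" "m i \<noteq> 0"
  shows "(\<Prod>i=1..n. fact (m i) :: real) = real (m i) * (\<Prod>j=1..n. fact ((m(i := m i - 1)) j))"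
proof -
  have "(\<Prod>i=1..n. fact (m i) :: real) = fact (m i) * (\<Prod>j\<in>{1..n} - {i}. fact (m j))"
    using assms by (intro prod.remove) auto
  also have "fact (m i) = real (m i) * fact (m i - 1)"
    using assms(2) by (cases "m i") auto
  also have "(\<Prod>j\<in>{1..n} - {i}. fact (m j) :: real) = (\<Prod>j\<in>{1..n} - {i}. fact ((m(i := m i - 1)) j))"
    by (intro prod.cong) auto
  also have "real (m i) * fact (m i - 1) * \<dots> = real (m i) * (\<Prod>j=1..n. fact ((m(i := m i - 1)) j))"
    using assms(1) by (subst prod.remove[where x = i and A = "{1..n}"]) auto
  finally show ?thesis .
qed

text \<open>In terms of matchings: one point of block i is fixed, and its partner is any of the m j
  points of another block j.\<close>

lemma wick_recursion:
  assumes "finsupp m" "i \<in> {1..n}" "m i \<noteq> 0"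
  shows "wick n m = (\<Sum>j\<in>{1..n} - {i}. real (m j) * wick n (m(i := m i - 1, j := m j - 1)))"
proof -
  let ?P = "\<Prod>j=1..n. fact ((m(i := m i - 1)) j) :: real"
  have "wick n m = ?P * (real (m i) * mps_exp (pair_sum n) m)"
    unfolding wick_def fact_prod_remove[of i n m, OF assms(2,3)] by simp
  also have "\<dots> = (\<Sum>j\<in>{1..n} - {i}. ?P * shift i (shift j (mps_exp (pair_sum n))) m)"
    unfolding mps_exp_pair_sum_degree[OF assms(1,2)] by (simp add: sum_distrib_left)
  also have "\<dots> = (\<Sum>j\<in>{1..n} - {i}. real (m j) * wick n (m(i := m i - 1, j := m j - 1)))"
  proof (intro sum.cong refl)
    fix j assume j: "j \<in> {1..n} - {i}"
    show "?P * shift i (shift j (mps_exp (pair_sum n))) m = real (m j) * wick n (m(i := m i - 1, j := m j - 1))"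
    proof (cases "m j = 0")
      case True
      then show ?thesis using j by (simp add: shift_def)
    next
      case False
      then show ?thesis
        using fact_prod_remove[of j n "m(i := m i - 1)"] j assms(3) by (simp add: shift_def wick_def)
    qed
  qed
  finally show ?thesis .
qed

section \<open>Partial couplings of two multisets\<close>

text \<open>The matrices of \<open>couplings\<close> written as multisets of matched pairs, so that
  adding or removing a single pair is elementary.\<close>

definition pair_msets :: "'a multiset \<Rightarrow> 'b multiset \<Rightarrow> ('a \<times> 'b) multiset set" where
  "pair_msets N N' = {M. image_mset fst M \<subseteq># N \<and> image_mset snd M \<subseteq># N'}"

lemma pair_msets_empty: "pair_msets {#} N' = {{#}}"
  by (auto simp: pair_msets_def)

lemma pair_msets_member:
  assumes "M \<in> pair_msets N N'" "(x, y) \<in># M"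
  shows "x \<in># N" "y \<in># N'"
proof -
  have "x \<in># image_mset fst M" "y \<in># image_mset snd M" using assms(2) by force+
  then show "x \<in># N" "y \<in># N'"
    using assms(1) unfolding pair_msets_def by (blast dest: mset_subset_eqD)+
qed

lemma pair_msets_add_iff:
  "add_mset (x, y) M \<in> pair_msets (add_mset x N) N' \<longleftrightarrow> y \<in># N' \<and> M \<in> pair_msets N (N' - {#y#})"
  by (auto simp: pair_msets_def insert_subset_eq_iff)

lemma pair_msets_add_subset:
  "pair_msets (add_mset x N) N' \<subseteq>
     pair_msets N N' \<union> (\<Union>y\<in>set_mset N'. add_mset (x, y) ` pair_msets N (N' - {#y#}))"
proof
  fix M assume M: "M \<in> pair_msets (add_mset x N) N'"
  show "M \<in> pair_msets N N' \<union> (\<Union>y\<in>set_mset N'. add_mset (x, y) ` pair_msets N (N' - {#y#}))"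
  proof (cases "\<exists>y. (x, y) \<in># M")
    case True
    then obtain y K where "M = add_mset (x, y) K" by (meson multi_member_split)
    with M show ?thesis using pair_msets_add_iff[of x y K N N'] by blast
  next
    case False
    then have "x \<notin># image_mset fst M" by force
    then have x: "count (image_mset fst M) x = 0" by (simp only: not_in_iff)
    have "image_mset fst M \<subseteq># N"
    proof (rule mset_subset_eqI)
      fix z
      have "count (image_mset fst M) z \<le> count (add_mset x N) z"
        using M by (intro mset_subset_eq_count) (simp add: pair_msets_def)
      with x show "count (image_mset fst M) z \<le> count N z" by (cases "z = x") simp_all
    qed
    with M show ?thesis by (simp add: pair_msets_def)
  qed
qed

lemma finite_pair_msets: "finite (pair_msets N N')"
proof (induction N arbitrary: N')
  case (add x N)
  show ?case by (rule finite_subset[OF pair_msets_add_subset]) (use add in auto)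
qed (simp add: pair_msets_empty)

definition coupling_sum :: "('a \<times> 'b \<Rightarrow> real) \<Rightarrow> ('a \<Rightarrow> real) \<Rightarrow> ('b \<Rightarrow> real) \<Rightarrow> 'a multiset \<Rightarrow> 'b multiset \<Rightarrow> real" where
  "coupling_sum q u v N N' = (\<Sum>M\<in>pair_msets N N'.
     mweight q M * mweight u (N - image_mset fst M) * mweight v (N' - image_mset snd M))"

lemma coupling_sum_empty: "coupling_sum q u v {#} N' = mweight v N'"
  by (simp add: coupling_sum_def pair_msets_empty)

lemma count_image_fst:
  assumes "finite S" "\<And>y. (x, y) \<in># M \<Longrightarrow> y \<in> S"
  shows "count (image_mset fst M) x = (\<Sum>y\<in>S. count M (x, y))"
proof -
  have "count (image_mset fst M) x = (\<Sum>z\<in>fst -` {x} \<inter> set_mset M. count M z)"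
    by (rule count_image_mset)
  also have "\<dots> = (\<Sum>z\<in>Pair x ` S. count M z)"
    using assms by (intro sum.mono_neutral_left) (auto simp: not_in_iff)
  also have "\<dots> = (\<Sum>y\<in>S. count M (x, y))"
    by (subst sum.reindex) (auto simp: inj_on_def)
  finally show ?thesis .
qed

text \<open>Every copy of x in N + x is either unmatched or matched with some y; the count of x in N + x
  on the left-hand side is split accordingly.\<close>

lemma coupling_sum_add:
  fixes N :: "'a multiset" and N' :: "'b multiset"
  shows "real (Suc (count N x)) * coupling_sum q u v (add_mset x N) N' =
    u x * coupling_sum q u v N N' + (\<Sum>y\<in>set_mset N'. q (x, y) * coupling_sum q u v N (N' - {#y#}))"
proof -
  define W where "W N N' M = mweight q M * mweight u (N - image_mset fst M) * mweight v (N' - image_mset snd M)"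
    for M and N :: "'a multiset" and N' :: "'b multiset"
  let ?C = "pair_msets (add_mset x N) N'"
  have split: "Suc (count N x) = count (add_mset x N - image_mset fst M) x + (\<Sum>y\<in>set_mset N'. count M (x, y))"
    if "M \<in> ?C" for M
  proof -
    have "y \<in># N'" if "(x, y) \<in># M" for y
      using pair_msets_member(2)[OF \<open>M \<in> ?C\<close> that] .
    then have "count (image_mset fst M) x = (\<Sum>y\<in>set_mset N'. count M (x, y))"
      by (intro count_image_fst) auto
    moreover have "count (image_mset fst M) x \<le> Suc (count N x)"
      using that mset_subset_eq_count[of "image_mset fst M" "add_mset x N" x] by (simp add: pair_msets_def)
    ultimately show ?thesis by simp
  qed
  have "real (Suc (count N x)) * coupling_sum q u v (add_mset x N) N' =
      (\<Sum>M\<in>?C. real (count (add_mset x N - image_mset fst M) x) * W (add_mset x N) N' M) +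
      (\<Sum>M\<in>?C. \<Sum>y\<in>set_mset N'. real (count M (x, y)) * W (add_mset x N) N' M)"
    unfolding coupling_sum_def W_def[symmetric] sum_distrib_left sum.distrib[symmetric]
    by (intro sum.cong refl) (subst split, auto simp: algebra_simps sum_distrib_left)
  \<comment> \<open>A matching that uses every copy of x has coefficient 0 here; those that leave
    one copy free are exactly the matchings of N and N'.\<close>
  also have "(\<Sum>M\<in>?C. real (count (add_mset x N - image_mset fst M) x) * W (add_mset x N) N' M) =
      (\<Sum>M\<in>pair_msets N N'. u x * W N N' M)"
  proof (rule sum.mono_neutral_cong_right)
    show "finite ?C" by (rule finite_pair_msets)
    show "pair_msets N N' \<subseteq> ?C"
      by (auto simp: pair_msets_def subseteq_mset_def intro: le_SucI)
    show "\<forall>M\<in>?C - pair_msets N N'. real (count (add_mset x N - image_mset fst M) x) * W (add_mset x N) N' M = 0"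
    proof
      fix M assume M: "M \<in> ?C - pair_msets N N'"
      then have 1: "image_mset fst M \<subseteq># add_mset x N" "\<not> image_mset fst M \<subseteq># N"
        by (auto simp: pair_msets_def)
      then obtain z where "count (image_mset fst M) z > count N z"
        by (auto simp: subseteq_mset_def not_le)
      moreover have "count (image_mset fst M) z \<le> count (add_mset x N) z"
        using 1(1) by (rule mset_subset_eq_count)
      ultimately have "count (add_mset x N - image_mset fst M) x = 0"
        by (auto split: if_splits)
      then show "real (count (add_mset x N - image_mset fst M) x) * W (add_mset x N) N' M = 0"
        by (simp only: of_nat_0 mult_zero_left)
    qed
    fix M assume "M \<in> pair_msets N N'"
    then have "add_mset x N - image_mset fst M = add_mset x (N - image_mset fst M)"
      by (auto simp: pair_msets_def multiset_eq_iff subseteq_mset_def Suc_diff_le)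
    then have "real (count (add_mset x N - image_mset fst M) x) * W (add_mset x N) N' M =
        mweight q M * (real (Suc (count (N - image_mset fst M) x)) * mweight u (add_mset x (N - image_mset fst M)))
          * mweight v (N' - image_mset snd M)"
      by (simp add: W_def del: of_nat_Suc)
    then show "real (count (add_mset x N - image_mset fst M) x) * W (add_mset x N) N' M = u x * W N N' M"
      unfolding mweight_add_mset by (simp add: W_def)
  qed
  also have "(\<Sum>M\<in>?C. \<Sum>y\<in>set_mset N'. real (count M (x, y)) * W (add_mset x N) N' M) =
      (\<Sum>y\<in>set_mset N'. \<Sum>M\<in>?C. real (count M (x, y)) * W (add_mset x N) N' M)"
    by (rule sum.swap)
  \<comment> \<open>Removing one pair (x, y) from M gives a matching of N and N' - y; the
    multiplicity of the pair turns the weight of M into q (x, y) times the weight of the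
    rest.\<close>
  also have "\<dots> = (\<Sum>y\<in>set_mset N'. \<Sum>M\<in>pair_msets N (N' - {#y#}). q (x, y) * W N (N' - {#y#}) M)"
  proof (rule sum.cong[OF refl])
    fix y assume y: "y \<in> set_mset N'"
    have "(\<Sum>M\<in>?C. real (count M (x, y)) * W (add_mset x N) N' M) =
        (\<Sum>M\<in>{M \<in> ?C. (x, y) \<in># M}. real (count M (x, y)) * W (add_mset x N) N' M)"
      by (intro sum.mono_neutral_right) (auto simp: finite_pair_msets not_in_iff)
    also have "\<dots> = (\<Sum>M\<in>pair_msets N (N' - {#y#}). q (x, y) * W N (N' - {#y#}) M)"
    proof (rule sum.reindex_bij_witness[where j = "\<lambda>M. M - {#(x, y)#}" and i = "add_mset (x, y)"])
      fix M assume "M \<in> {M \<in> ?C. (x, y) \<in># M}"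
      then obtain K where K: "M = add_mset (x, y) K" "M \<in> ?C" by (auto dest: multi_member_split)
      then show "add_mset (x, y) (M - {#(x, y)#}) = M" "M - {#(x, y)#} \<in> pair_msets N (N' - {#y#})"
        using pair_msets_add_iff[of x y K N N'] by simp_all
      show "q (x, y) * W N (N' - {#y#}) (M - {#(x, y)#}) = real (count M (x, y)) * W (add_mset x N) N' M"
      proof -
        have "N' - image_mset snd M = N' - {#y#} - image_mset snd K" using K by simp
        then have "real (count M (x, y)) * W (add_mset x N) N' M =
            real (Suc (count K (x, y))) * mweight q (add_mset (x, y) K) *
              mweight u (N - image_mset fst K) * mweight v (N' - {#y#} - image_mset snd K)"
          using K(1) by (simp add: W_def del: of_nat_Suc)
        then show ?thesis unfolding mweight_add_mset using K(1) by (auto simp: W_def)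
      qed
    next
      fix M assume "M \<in> pair_msets N (N' - {#y#})"
      then show "add_mset (x, y) M - {#(x, y)#} = M" "add_mset (x, y) M \<in> {M \<in> ?C. (x, y) \<in># M}"
        using y pair_msets_add_iff[of x y M N N'] by simp_all
    qed
    finally show "(\<Sum>M\<in>?C. real (count M (x, y)) * W (add_mset x N) N' M) =
        (\<Sum>M\<in>pair_msets N (N' - {#y#}). q (x, y) * W N (N' - {#y#}) M)" .
  qed
  finally show ?thesis
    by (simp add: coupling_sum_def W_def sum_distrib_left)
qed

lemma coupling_sum_nonneg:
  assumes "\<And>x y. x \<in># N \<Longrightarrow> y \<in># N' \<Longrightarrow> q (x, y) \<ge> 0" "\<And>x. x \<in># N \<Longrightarrow> u x \<ge> 0" "\<And>y. y \<in># N' \<Longrightarrow> v y \<ge> 0"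
  shows "coupling_sum q u v N N' \<ge> 0"
  unfolding coupling_sum_def
proof (intro sum_nonneg mult_nonneg_nonneg mweight_nonneg)
  fix M z assume M: "M \<in> pair_msets N N'" and z: "z \<in># M"
  then have "fst z \<in># N" "snd z \<in># N'"
    using pair_msets_member[of M N N' "fst z" "snd z"] by auto
  then show "q z \<ge> 0" using assms(1)[of "fst z" "snd z"] by simp
qed (auto dest: in_diffD assms(2,3))

lemma rowsum_count: "rowsum (count M) \<tau> = count (image_mset fst M) \<tau>"
proof -
  have "finite {y. (\<tau>, y) \<in># M}"
    by (rule finite_subset[of _ "snd ` set_mset M"]) force+
  then show ?thesis unfolding rowsum_def by (subst count_image_fst[of "{y. (\<tau>, y) \<in># M}"]) auto
qed

lemma colsum_count: "colsum (count M) \<tau> = count (image_mset snd M) \<tau>"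
proof -
  let ?S = "{x. (x, \<tau>) \<in># M}"
  have "count (image_mset snd M) \<tau> = (\<Sum>z\<in>snd -` {\<tau>} \<inter> set_mset M. count M z)"
    by (rule count_image_mset)
  also have "snd -` {\<tau>} \<inter> set_mset M = (\<lambda>x. (x, \<tau>)) ` ?S" by auto
  also have "(\<Sum>z\<in>(\<lambda>x. (x, \<tau>)) ` ?S. count M z) = (\<Sum>x\<in>?S. count M (x, \<tau>))"
    by (subst sum.reindex) (auto simp: inj_on_def)
  finally show ?thesis unfolding colsum_def by simp
qed

lemma bij_betw_count_couplings:
  "bij_betw count (pair_msets N N') (couplings N N')"
proof (rule bij_betw_byWitness[where f' = Abs_multiset])
  have char: "count M \<in> couplings N N' \<longleftrightarrow> M \<in> pair_msets N N'" for M
  proof -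
    have "z \<in> set_mset N \<times> set_mset N'" if "M \<in> pair_msets N N'" "z \<in># M" for z
      using that pair_msets_member[of M N N' "fst z" "snd z"] by (cases z) auto
    then show ?thesis
      by (auto simp: couplings_def rowsum_count colsum_count pair_msets_def subseteq_mset_def)
  qed
  have fin: "count (Abs_multiset f) = f" if "f \<in> couplings N N'" for f
  proof -
    have "{x. 0 < f x} \<subseteq> set_mset N \<times> set_mset N'" using that by (auto simp: couplings_def)
    then have "finite {x. 0 < f x}" by (rule finite_subset) auto
    then show ?thesis by (rule count_Abs_multiset)
  qed
  show "\<forall>M\<in>pair_msets N N'. Abs_multiset (count M) = M" by (simp add: count_inverse)
  show "\<forall>f\<in>couplings N N'. count (Abs_multiset f) = f" using fin by blast
  show "count ` pair_msets N N' \<subseteq> couplings N N'" using char by blast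
  show "Abs_multiset ` couplings N N' \<subseteq> pair_msets N N'" using char fin by (metis image_subsetI)
qed

section \<open>Likelihood ratios\<close>

context poisson_charlier
begin

context
  fixes s :: real and l :: "'a \<Rightarrow> 'a \<Rightarrow> real" and L :: "'a multiset \<Rightarrow> 'a multiset \<Rightarrow> real"
  assumes L0: "\<And>N'. N' \<in> msets A \<Longrightarrow> L {#} N' = exp (lam * s) * (1 - s) ^ size N'"
    and LS: "\<And>x N N'. x \<in> A \<Longrightarrow> N \<in> msets A \<Longrightarrow> N' \<in> msets A \<Longrightarrow>
        L (add_mset x N) N' = (1 - s) * L N N' + s / lam * (\<Sum>y\<in>#N'. l x y * L N (N' - {#y#}))"
begin

text \<open>Induction on N: in the recursion of L the new child is unmatched with total weight 1 -
  s, or matched with some y, where Mecke's formula for \<open>prob\<close> and the marginal of l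
  give weight s.\<close>

lemma kernel_marginal:
  assumes s: "s \<le> 1" and l: "\<And>x. x \<in> A \<Longrightarrow> ((\<lambda>y. p y * l x y) has_sum 1) A"
    and N: "N \<in> msets A"
  shows "((\<lambda>N'. prob N' * L N N') has_sum 1) (msets A)"
  using N
proof (induction N)
  case empty
  \<comment> \<open>Thinning: the factor (1 - s) ^ size is absorbed into the intensity, which is
    nonnegative because s is at most 1.\<close>
  have "((\<lambda>x. (1 - s) * (lam * p x)) has_sum (1 - s) * (lam * 1)) A"
    by (intro has_sum_cmult_right p_sum)
  then have "(mweight (\<lambda>x. (1 - s) * (lam * p x)) has_sum exp ((1 - s) * (lam * 1))) (msets A)"
    by (rule has_sum_mweight) (use s lam_pos p_nonneg in auto)
  from has_sum_cmult_right[OF this, of "exp (- lam) * exp (lam * s)"]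
  have "((\<lambda>N'. exp (- lam) * exp (lam * s) * mweight (\<lambda>x. (1 - s) * (lam * p x)) N') has_sum 1) (msets A)"
    by (simp add: algebra_simps flip: exp_add)
  then show ?case
    by (rule has_sum_cong[THEN iffD1, rotated]) (simp add: L0 prob_def mweight_scale[of "1 - s"])
next
  case (add x N)
  then have x: "x \<in> A" and N: "N \<in> msets A" and IH: "((\<lambda>N'. prob N' * L N N') has_sum 1) (msets A)"
    by auto
  have "((\<lambda>(y, N'). p y * l x y * (prob N' * L N N')) has_sum 1 * 1) (A \<times> msets A)"
    by (rule has_sum_mult_product[OF l[OF x] IH])
  then have "((\<lambda>(y, N'). p y * prob N' * (l x y * L N N')) has_sum 1) (A \<times> msets A)"
    by (simp add: mult_ac)
  from prob_mecke[OF this]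
  have "((\<lambda>N'. (1 - s) * (prob N' * L N N') +
      s / lam * (prob N' * (\<Sum>y\<in>#N'. l x y * L N (N' - {#y#})))) has_sum (1 - s) * 1 + s / lam * (lam * 1)) (msets A)"
    by (intro has_sum_add has_sum_cmult_right IH) simp
  then have "((\<lambda>N'. prob N' * L (add_mset x N) N') has_sum (1 - s) * 1 + s / lam * (lam * 1)) (msets A)"
    by (rule has_sum_cong[THEN iffD1, rotated]) (simp add: LS[OF x N] algebra_simps)
  then show ?case using lam_pos by simp
qed

text \<open>At s = 1 no child stays unmatched, and l allows only matches of equal children, so the
  two multisets must coincide.\<close>

lemma kernel_diagonal:
  assumes s: "s = 1" and l: "\<And>x y. x \<in> A \<Longrightarrow> y \<in> A \<Longrightarrow> l x y = (if x = y then 1 / p x else 0)"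
    and p: "\<And>x. x \<in> A \<Longrightarrow> p x > 0" and N: "N \<in> msets A" "N' \<in> msets A"
  shows "L N N' = (if N = N' then 1 / prob N else 0)"
  using N
proof (induction N arbitrary: N')
  case empty
  \<comment> \<open>(1 - s) ^ size N' is 0 here, except for empty N', where 0 ^ 0 = 1.\<close>
  then show ?case using s L0[of N'] by (auto simp: prob_def exp_minus divide_inverse nonempty_has_size)
next
  case (add x N)
  then have x: "x \<in> A" and N: "N \<in> msets A" by auto
  have "(\<Sum>y\<in>#N'. l x y * L N (N' - {#y#})) =
      (\<Sum>y\<in>#N'. if y = x then 1 / p x * L N (N' - {#x#}) else 0)"
    using add.prems by (intro arg_cong[where f = sum_mset] image_mset_cong) (auto simp: l dest: msets_member)
  also have "\<dots> = real (count N' x) * (1 / p x * L N (N' - {#x#}))"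
    by (simp add: sum_mset_delta)
  finally have eq: "L (add_mset x N) N' = real (count N' x) / (lam * p x) * L N (N' - {#x#})"
    using LS[OF x N, of N'] add.prems s by simp
  show ?case
  proof (cases "x \<in># N'")
    case True
    then obtain K where K: "N' = add_mset x K" by (meson multi_member_split)
    have pr: "real (Suc (count N x)) * prob (add_mset x N) = lam * p x * prob N"
      using mweight_add_mset[of N x "\<lambda>x. lam * p x"] by (simp add: prob_def)
    have pos: "prob (add_mset x N) > 0" "prob N > 0" "lam * p x > 0"
      using x N lam_pos by (auto simp: prob_def intro!: mweight_pos mult_pos_pos p intro: msets_member)
    have "real (Suc (count N x)) / (lam * p x) * (1 / prob N) = 1 / prob (add_mset x N)"
      using pr pos lam_pos p[OF x] by (simp add: field_simps del: of_nat_Suc)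
    then show ?thesis using eq K add by (auto simp: mult.commute)
  next
    case False
    then show ?thesis using eq by (auto simp: not_in_iff)
  qed
qed

end

text \<open>The likelihood ratio of two Poisson families with intensities q (matched pairs) and
  (1 - s) * lam * p (unmatched elements) against independent families of intensity lam * p.\<close>

lemma coupling_ratio_recursion:
  assumes p: "\<And>x. x \<in> A \<Longrightarrow> p x > 0"
    and q: "\<And>x y. x \<in> A \<Longrightarrow> y \<in> A \<Longrightarrow> q (x, y) = lam * s * (p x * p y * l x y)"
    and u: "u = (\<lambda>x. lam * (1 - s) * p x)"
    and L: "\<And>N N'. N \<in> msets A \<Longrightarrow> N' \<in> msets A \<Longrightarrow>
       L N N' = exp (- (lam * s) - 2 * (lam * (1 - s))) * coupling_sum q u u N N' / (prob N * prob N')"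
  shows "N' \<in> msets A \<Longrightarrow> L {#} N' = exp (lam * s) * (1 - s) ^ size N'"
    and "x \<in> A \<Longrightarrow> N \<in> msets A \<Longrightarrow> N' \<in> msets A \<Longrightarrow>
        L (add_mset x N) N' = (1 - s) * L N N' + s / lam * (\<Sum>y\<in>#N'. l x y * L N (N' - {#y#}))"
proof -
  define w where "w = mweight (\<lambda>x. lam * p x)"
  have wpos: "w N > 0" if "N \<in> msets A" for N
    using that p lam_pos unfolding w_def by (intro mweight_pos mult_pos_pos) (auto dest: msets_member)
  have wrem: "w (N - {#y#}) = real (count N y) * w N / (lam * p y)" if "y \<in># N" "N \<in> msets A" for y N
    using mweight_remove[OF that(1), of "\<lambda>x. lam * p x"] p[of y] that lam_pos
    by (auto simp: w_def field_simps dest: msets_member)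
  \<comment> \<open>The intensities in the numerator have total mass lam * s + 2 * lam * (1 - s),
    against 2 * lam in the denominator; the surplus is exp (lam * s).\<close>
  have e: "exp (- (lam * s) - 2 * (lam * (1 - s))) = exp (lam * s) * (exp (- lam) * exp (- lam))"
    by (simp add: algebra_simps flip: exp_add)
  have L': "L N N' = exp (lam * s) * coupling_sum q u u N N' / (w N * w N')"
    if "N \<in> msets A" "N' \<in> msets A" for N N'
    unfolding L[OF that] e prob_def w_def by simp
  show "L {#} N' = exp (lam * s) * (1 - s) ^ size N'" if "N' \<in> msets A"
  proof -
    have "mweight u N' = (1 - s) ^ size N' * w N'"
      using mweight_scale[of "1 - s" "\<lambda>x. lam * p x" N'] by (simp add: u w_def mult_ac)
    then show ?thesis using L'[OF msets_empty that] wpos[OF that]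
      by (simp add: coupling_sum_empty w_def)
  qed
  show "L (add_mset x N) N' = (1 - s) * L N N' + s / lam * (\<Sum>y\<in>#N'. l x y * L N (N' - {#y#}))"
    if x: "x \<in> A" and N: "N \<in> msets A" and N': "N' \<in> msets A"
  proof -
    define E where "E = exp (lam * s) / (lam * p x * w N * w N')"
    have pos: "lam * p x > 0" using x p lam_pos by simp
    have "real (Suc (count N x)) * w (add_mset x N) = lam * p x * w N"
      by (simp add: w_def mweight_add_mset del: of_nat_Suc)
    then have wadd: "w (add_mset x N) = lam * p x * w N / real (Suc (count N x))"
      by (simp add: field_simps del: of_nat_Suc)
    have "L (add_mset x N) N' = E * (real (Suc (count N x)) * coupling_sum q u u (add_mset x N) N')"
      using L'[of "add_mset x N" N'] x N N' by (simp add: wadd E_def del: of_nat_Suc)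
    also have "\<dots> = E * u x * coupling_sum q u u N N' +
        (\<Sum>y\<in>set_mset N'. E * q (x, y) * coupling_sum q u u N (N' - {#y#}))"
      unfolding coupling_sum_add by (simp add: sum_distrib_left algebra_simps)
    also have "E * u x * coupling_sum q u u N N' = (1 - s) * L N N'"
      using L'[OF N N'] lam_pos p[OF x] by (simp add: E_def u)
    also have "(\<Sum>y\<in>set_mset N'. E * q (x, y) * coupling_sum q u u N (N' - {#y#})) =
        (\<Sum>y\<in>set_mset N'. s / lam * (real (count N' y) * (l x y * L N (N' - {#y#}))))"
    proof (rule sum.cong[OF refl])
      fix y assume y: "y \<in> set_mset N'"
      then have yA: "y \<in> A" using N' by (auto dest: msets_member)
      have "L N (N' - {#y#}) = exp (lam * s) * coupling_sum q u u N (N' - {#y#}) /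
          (w N * (real (count N' y) * w N' / (lam * p y)))"
        using L'[of N "N' - {#y#}"] N N' wrem[OF y N'] by simp
      moreover have "real (count N' y) \<noteq> 0" "p y > 0" "p x > 0" "w N > 0" "w N' > 0"
        using y yA x p wpos N N' by auto
      ultimately show "E * q (x, y) * coupling_sum q u u N (N' - {#y#}) =
          s / lam * (real (count N' y) * (l x y * L N (N' - {#y#})))"
        using lam_pos by (simp add: E_def q[OF x yA] field_simps)
    qed
    finally show ?thesis by (simp add: sum_mset_sum_count sum_distrib_left)
  qed
qed

end

section \<open>Trees\<close>

lemma X_0: "X 0 = {leaf}"
proof -
  have "t = leaf" if "theight t = 0" for t
  proof (cases t)
    case (Node M)
    have "M = {#}"
    proof (rule ccontr)
      assume "M \<noteq> {#}"
      then obtain x where "x \<in># M" by auto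
      then have "Suc (theight x) \<le> theight t" by (simp add: Node)
      with that show False by simp
    qed
    then show ?thesis by (simp add: Node leaf_def)
  qed
  then show ?thesis by (auto simp: X_def leaf_def)
qed

lemma Node_in_X_Suc [simp]: "Node M \<in> X (Suc d) \<longleftrightarrow> M \<in> msets (X d)"
  by (auto simp: X_def msets_def)

lemma children_in_msets: "t \<in> X (Suc d) \<Longrightarrow> children t \<in> msets (X d)"
  by (cases t) simp

lemma leaf_in_X [simp]: "leaf \<in> X d"
  by (simp add: X_def leaf_def)

lemma children_leaf [simp]: "children leaf = {#}"
  by (simp add: leaf_def)

lemma tsize_leaf [simp]: "tsize leaf = 1"
  by (simp add: leaf_def)

lemma tsize_pos: "tsize t \<ge> 1"
  by (cases t) simp

lemma has_sum_X_Suc: "(f has_sum v) (X (Suc d)) \<longleftrightarrow> ((\<lambda>M. f (Node M)) has_sum v) (msets (X d))"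
proof -
  have "bij_betw Node (msets (X d)) (X (Suc d))"
    by (rule bij_betwI[where g = children]) (auto simp: children_in_msets, metis children.simps tree.exhaust)
  from has_sum_reindex_bij_betw[OF this, of f v] show ?thesis by simp
qed

section \<open>Galton-Watson weights and Charlier functions of trees\<close>

lemma prod_mset_prod_count:
  fixes m :: "'a \<Rightarrow> real"
  shows "(\<Prod>x\<in>#M. m x) = (\<Prod>x\<in>set_mset M. m x ^ count M x)"
proof (induction M)
  case (add y M)
  let ?S = "insert y (set_mset M)"
  have "(\<Prod>x\<in>?S. m x ^ count (add_mset y M) x) = (\<Prod>x\<in>?S. (if x = y then m x else 1) * m x ^ count M x)"
    by (intro prod.cong) auto
  also have "\<dots> = m y * (\<Prod>x\<in>?S. m x ^ count M x)"
    by (simp add: prod.distrib)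
  also have "(\<Prod>x\<in>?S. m x ^ count M x) = (\<Prod>x\<in>set_mset M. m x ^ count M x)"
    by (intro prod.mono_neutral_right) (auto simp: not_in_iff)
  finally show ?case using add by simp
qed simp

lemma pois_family_count:
  assumes "M \<in> msets I"
  shows "pois_family I m (count M) = exp (- infsum m I) * mweight m M"
proof -
  have "{i. count M i \<noteq> 0} = set_mset M" by (auto simp: count_eq_zero_iff)
  moreover have "(\<Prod>x\<in>#M. m x) = (\<Prod>x\<in>set_mset M. m x ^ count M x)"
    by (rule prod_mset_prod_count)
  ultimately show ?thesis
    using assms by (auto simp: pois_family_def mweight_def mfact_def prod_dividef msets_def count_eq_zero_iff)
qed

text \<open>A label is itself a tree, and its children are the labels of the previous depth. The
  label of the constant function is \<open>leaf\<close> at every depth.\<close>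

fun tree_charlier :: "real \<Rightarrow> nat \<Rightarrow> tree \<Rightarrow> tree \<Rightarrow> real" where
  "tree_charlier lam 0 \<beta> t = 1"
| "tree_charlier lam (Suc d) \<beta> t =
     charlier (1 / sqrt lam) (\<lambda>g. if g = leaf then - sqrt lam else 0) (tree_charlier lam d) (children t) (children \<beta>)
       / sqrt (mfact (children \<beta>))"

lemma tree_charlier_leaf: "tree_charlier lam d leaf t = 1"
  by (cases d) simp_all

lemma GW_Suc_Node:
  assumes "poisson_charlier lam (GW lam d) (X d) F B g0" "M \<in> msets (X d)"
  shows "GW lam (Suc d) (Node M) = poisson_charlier.prob lam (GW lam d) M"
proof -
  interpret poisson_charlier lam "GW lam d" "X d" F B g0 by fact
  have "infsum (\<lambda>\<tau>. lam * GW lam d \<tau>) (X d) = lam"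
    by (intro infsumI) (use has_sum_cmult_right[OF p_sum, of lam] in simp)
  then show ?thesis using assms(2) by (simp add: pois_family_count prob_def)
qed

lemma tree_charlier_moment:
  assumes "poisson_charlier lam (GW lam d) (X d) (tree_charlier lam d) (X d) leaf"
    and "finite I" and \<beta>: "\<forall>i\<in>I. \<beta> i \<in> X (Suc d)"
  shows "((\<lambda>t. GW lam (Suc d) t * (\<Prod>i\<in>I. tree_charlier lam (Suc d) (\<beta> i) t)) has_sum
     poisson_charlier.moment lam (GW lam d) (X d) (tree_charlier lam d) leaf I (\<lambda>i. children (\<beta> i)) /
     (\<Prod>i\<in>I. sqrt (mfact (children (\<beta> i))))) (X (Suc d))"
proof -
  interpret poisson_charlier lam "GW lam d" "X d" "tree_charlier lam d" "X d" leaf by fact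
  have "((\<lambda>t. prob t * (\<Prod>i\<in>I. ch t (children (\<beta> i)))) has_sum moment I (\<lambda>i. children (\<beta> i))) (msets (X d))"
    unfolding moment_def using \<beta>
    by (intro has_sum_infsum moment_summable assms(2)) (auto simp: children_in_msets)
  from has_sum_cmult_left[OF this, of "1 / (\<Prod>i\<in>I. sqrt (mfact (children (\<beta> i))))"]
  have "((\<lambda>t. prob t * (\<Prod>i\<in>I. ch t (children (\<beta> i))) * (1 / (\<Prod>i\<in>I. sqrt (mfact (children (\<beta> i)))))) has_sum
      moment I (\<lambda>i. children (\<beta> i)) / (\<Prod>i\<in>I. sqrt (mfact (children (\<beta> i))))) (msets (X d))"
    by simp
  then show ?thesis
    unfolding has_sum_X_Suc
    by (rule has_sum_cong[THEN iffD1, rotated])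
       (simp add: GW_Suc_Node[OF assms(1)] prod_dividef ch_def mean_def[abs_def] del: GW.simps)
qed

text \<open>The locale takes moments over multisets of labels but produces them over indexed
  families; this passes from one to the other at the next depth.\<close>

lemma prod_mset_as_prod:
  "\<exists>\<beta> :: nat \<Rightarrow> 'a. (\<forall>i\<in>{1..size gs}. \<beta> i \<in># gs) \<and>
     (\<forall>F :: 'a \<Rightarrow> real. (\<Prod>g\<in>#gs. F g) = (\<Prod>i=1..size gs. F (\<beta> i)))"
proof -
  obtain xs where xs: "mset xs = gs" using ex_mset by blast
  have "(\<Prod>g\<in>#gs. F g) = (\<Prod>i=1..size gs. F (xs ! (i - 1)))" for F :: "'a \<Rightarrow> real"
  proof -
    have "(\<Prod>g\<in>#gs. F g) = prod_list (map F xs)"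
      using xs by (metis mset_map prod_mset_prod_list)
    also have "\<dots> = (\<Prod>i<length xs. F (xs ! i))"
      by (simp add: prod.list_conv_set_nth atLeast0LessThan)
    also have "\<dots> = (\<Prod>i=1..length xs. F (xs ! (i - 1)))"
      by (rule prod.reindex_bij_witness[where i = "\<lambda>i. i - 1" and j = Suc]) auto
    finally show ?thesis using xs by auto
  qed
  moreover have "\<forall>i\<in>{1..size gs}. xs ! (i - 1) \<in># gs"
    using xs by auto
  ultimately show ?thesis by (intro exI[of _ "\<lambda>i. xs ! (i - 1)"]) blast
qed

text \<open>The induction on depth: \<open>prob_sum\<close>, \<open>moment_pair\<close> and
  \<open>moment_summable\<close> at depth d provide the locale assumptions at depth d + 1.
  Positivity of the weights makes all likelihood ratios well defined.\<close>

lemma poisson_charlier_trees: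
  assumes lam: "lam > 0"
  shows "poisson_charlier lam (GW lam d) (X d) (tree_charlier lam d) (X d) leaf \<and> (\<forall>t\<in>X d. GW lam d t > 0)"
proof (induction d)
  case 0
  have "poisson_charlier lam (GW lam 0) (X 0) (tree_charlier lam 0) (X 0) leaf"
    by unfold_locales (auto simp: X_0 lam has_sum_finite_iff)
  moreover have "\<forall>t\<in>X 0. GW lam 0 t > 0" by (simp add: X_0)
  ultimately show ?case by blast
next
  case (Suc d)
  then have pc: "poisson_charlier lam (GW lam d) (X d) (tree_charlier lam d) (X d) leaf" and pos: "\<forall>t\<in>X d. GW lam d t > 0"
    by auto
  interpret poisson_charlier lam "GW lam d" "X d" "tree_charlier lam d" "X d" leaf by fact
  note GWS = GW_Suc_Node[OF pc]
  have pos': "GW lam (Suc d) t > 0" if t: "t \<in> X (Suc d)" for t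
  proof (cases t)
    case (Node M)
    have M: "M \<in> msets (X d)" using t Node by simp
    then have "mweight (\<lambda>x. lam * GW lam d x) M > 0"
      using lam pos by (intro mweight_pos mult_pos_pos) (auto dest: msets_member)
    then show ?thesis using GWS[OF M] by (simp add: Node prob_def del: GW.simps)
  qed
  have "poisson_charlier lam (GW lam (Suc d)) (X (Suc d)) (tree_charlier lam (Suc d)) (X (Suc d)) leaf"
  proof
    show "(GW lam (Suc d) has_sum 1) (X (Suc d))"
      unfolding has_sum_X_Suc
      by (rule has_sum_cong[THEN iffD1, OF _ prob_sum]) (simp add: GWS del: GW.simps)
    fix g h assume g: "g \<in> X (Suc d)" and h: "h \<in> X (Suc d)"
    from moment_pair[OF children_in_msets[OF g] children_in_msets[OF h]]
    have "((\<lambda>t. 1 / (sqrt (mfact (children g)) * sqrt (mfact (children h))) * (prob t * ch t (children g) * ch t (children h)))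
        has_sum 1 / (sqrt (mfact (children g)) * sqrt (mfact (children h))) *
          (if children g = children h then mfact (children g) else 0)) (msets (X d))"
      by (rule has_sum_cmult_right)
    also have "1 / (sqrt (mfact (children g)) * sqrt (mfact (children h))) *
          (if children g = children h then mfact (children g) else 0) = (if g = h then 1 else 0)"
      using mfact_pos[of "children g"] by (cases g; cases h) auto
    finally show "((\<lambda>x. GW lam (Suc d) x * tree_charlier lam (Suc d) g x * tree_charlier lam (Suc d) h x) has_sum (if g = h then 1 else 0)) (X (Suc d))"
      unfolding has_sum_X_Suc
      by (rule has_sum_cong[THEN iffD1, rotated])
         (simp add: GWS ch_def mean_def[abs_def] del: GW.simps)
  next
    fix gs assume gs: "gs \<in> msets (X (Suc d))"
    obtain \<beta> where \<beta>: "\<forall>i\<in>{1..size gs}. \<beta> i \<in># gs"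
      "\<forall>F :: tree \<Rightarrow> real. (\<Prod>g\<in>#gs. F g) = (\<Prod>i=1..size gs. F (\<beta> i))"
      using prod_mset_as_prod[of gs] by blast
    then have "\<forall>i\<in>{1..size gs}. \<beta> i \<in> X (Suc d)" using gs by (auto dest: msets_member)
    from has_sum_imp_summable[OF tree_charlier_moment[OF pc _ this]]
    show "(\<lambda>x. GW lam (Suc d) x * (\<Prod>g\<in>#gs. tree_charlier lam (Suc d) g x)) summable_on X (Suc d)"
      using \<beta>(2) by simp
  qed (use lam pos' tree_charlier_leaf in \<open>auto simp del: GW.simps tree_charlier.simps intro: less_imp_le\<close>)
  then show ?case using pos' by blast
qed

text \<open>The size exponent is additive over children, so s ^ (tsize - 1) at a tree is the product
  of s ^ tsize over its children. Hence the weight w g = s ^ tsize g in the Charlier kernel, with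
  value s at \<open>leaf\<close>.\<close>

lemma has_sum_tree_kernel:
  assumes lam: "lam > 0" and s: "s \<ge> 0"
    and pc: "poisson_charlier lam (GW lam d) (X d) (tree_charlier lam d) (X d) leaf"
    and IH: "\<And>t t'. t \<in> X d \<Longrightarrow> t' \<in> X d \<Longrightarrow>
      ((\<lambda>\<beta>. s ^ (tsize \<beta> - 1) * tree_charlier lam d \<beta> t * tree_charlier lam d \<beta> t') has_sum l t t') (X d)"
    and L0: "\<And>N'. N' \<in> msets (X d) \<Longrightarrow> L {#} N' = exp (lam * s) * (1 - s) ^ size N'"
    and LS: "\<And>x N N'. x \<in> X d \<Longrightarrow> N \<in> msets (X d) \<Longrightarrow> N' \<in> msets (X d) \<Longrightarrow>
        L (add_mset x N) N' = (1 - s) * L N N' + s / lam * (\<Sum>y\<in>#N'. l x y * L N (N' - {#y#}))"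
    and t: "t \<in> X (Suc d)" "t' \<in> X (Suc d)"
  shows "((\<lambda>\<beta>. s ^ (tsize \<beta> - 1) * tree_charlier lam (Suc d) \<beta> t * tree_charlier lam (Suc d) \<beta> t') has_sum L (children t) (children t')) (X (Suc d))"
proof -
  let ?c = "\<lambda>g. if g = leaf then - sqrt lam else 0"
  \<comment> \<open>Sizes are positive, so the truncated subtraction is exact.\<close>
  have sz: "s ^ tsize g = s * s ^ (tsize g - 1)" for g
    using tsize_pos[of g] by (cases "tsize g") auto
  have FF: "((\<lambda>g. s ^ tsize g * tree_charlier lam d g x * tree_charlier lam d g y) has_sum s * l x y) (X d)"
    if "x \<in> X d" "y \<in> X d" for x y
    using has_sum_cmult_right[OF IH[OF that], of s] unfolding sz by (simp add: mult_ac)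
  have "((\<lambda>b. mweight (\<lambda>g. s ^ tsize g) b * charlier (1 / sqrt lam) ?c (tree_charlier lam d) (children t) b *
      charlier (1 / sqrt lam) ?c (tree_charlier lam d) (children t') b) has_sum L (children t) (children t')) (msets (X d))"
    by (rule has_sum_charlier_kernel[where ?g0.0 = leaf and A = "X d" and s = s and l = l])
       (use lam s FF L0 LS t children_in_msets tree_charlier_leaf in auto)
  moreover have "mweight (\<lambda>g. s ^ tsize g) b = s ^ (tsize (Node b) - 1) / (sqrt (mfact b) * sqrt (mfact b))" for b
  proof -
    have "(\<Prod>g\<in>#b. s ^ tsize g) = s ^ (\<Sum>g\<in>#b. tsize g)"
      by (induction b) (auto simp: power_add)
    then show ?thesis using mfact_pos[of b] by (simp add: mweight_def)
  qed
  ultimately show ?thesis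
    unfolding has_sum_X_Suc by (simp add: mult_ac)
qed

text \<open>The marginals of the correlated model are Galton-Watson, so its total mass is 1.\<close>

definition LR_marginal :: "real \<Rightarrow> real \<Rightarrow> nat \<Rightarrow> bool" where
  "LR_marginal lam s d \<longleftrightarrow> (\<forall>t\<in>X d. ((\<lambda>t'. GW lam d t' * LR lam s d t t') has_sum 1) (X d)) \<and>
     (\<forall>t\<in>X d. \<forall>t'\<in>X d. Pcorr lam s d t t' \<ge> 0)"

section \<open>Likelihood ratios of correlated Galton-Watson trees\<close>

lemma Pcorr_LR:
  assumes "lam > 0" "t \<in> X d" "t' \<in> X d"
  shows "Pcorr lam s d t t' = GW lam d t * GW lam d t' * LR lam s d t t'"
  using poisson_charlier_trees[OF assms(1), of d] assms(2,3) by (auto simp: LR_def)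

lemma Pcorr_mass:
  assumes lam: "lam > 0" and marg: "LR_marginal lam s d"
  shows "((\<lambda>(t, t'). Pcorr lam s d t t') has_sum 1) (X d \<times> X d)"
proof -
  interpret poisson_charlier lam "GW lam d" "X d" "tree_charlier lam d" "X d" leaf
    using poisson_charlier_trees[OF lam] by blast
  have row: "((\<lambda>t'. case (t, t') of (t, t') \<Rightarrow> Pcorr lam s d t t') has_sum GW lam d t) (X d)" if t: "t \<in> X d" for t
  proof -
    have "((\<lambda>t'. GW lam d t * (GW lam d t' * LR lam s d t t')) has_sum GW lam d t * 1) (X d)"
      by (rule has_sum_cmult_right) (use marg t in \<open>auto simp: LR_marginal_def\<close>)
    then have "((\<lambda>t'. GW lam d t * (GW lam d t' * LR lam s d t t')) has_sum GW lam d t) (X d)"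
      by simp
    then show ?thesis
      using t by (simp add: Pcorr_LR[OF lam] mult_ac cong: has_sum_cong)
  qed
  show ?thesis
  proof (rule has_sum_SigmaI[OF row p_sum])
    \<comment> \<open>Nonnegativity, the second half of \<open>LR_marginal\<close>, allows the mass
      to be summed row by row.\<close>
    show "(\<lambda>(t, t'). Pcorr lam s d t t') summable_on X d \<times> X d"
      using marg by (intro summable_on_SigmaI[OF row has_sum_imp_summable[OF p_sum]]) (auto simp: LR_marginal_def)
  qed
qed

text \<open>Mass 1 at depth d identifies the total intensity of the matched pairs as lam * s; the
  unmatched children on each side have total intensity lam * (1 - s).\<close>

lemma Pcorr_Suc_Node:
  assumes lam: "lam > 0" and marg: "LR_marginal lam s d"
    and N: "N \<in> msets (X d)" "N' \<in> msets (X d)"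
  shows "Pcorr lam s (Suc d) (Node N) (Node N') =
    exp (- (lam * s) - 2 * (lam * (1 - s))) * coupling_sum (\<lambda>(x, y). lam * s * Pcorr lam s d x y)
      (\<lambda>x. lam * (1 - s) * GW lam d x) (\<lambda>x. lam * (1 - s) * GW lam d x) N N'"
proof -
  interpret poisson_charlier lam "GW lam d" "X d" "tree_charlier lam d" "X d" leaf
    using poisson_charlier_trees[OF lam] by blast
  let ?q = "\<lambda>(x, y). lam * s * Pcorr lam s d x y" and ?u = "\<lambda>x. lam * (1 - s) * GW lam d x"
  have q: "infsum ?q (X d \<times> X d) = lam * s"
    using has_sum_cmult_right[OF Pcorr_mass[OF lam marg], of "lam * s"]
    by (intro infsumI) (simp add: case_prod_unfold)
  have u: "infsum ?u (X d) = lam * (1 - s)"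
    using has_sum_cmult_right[OF p_sum, of "lam * (1 - s)"] by (intro infsumI) simp
  have "Pcorr lam s (Suc d) (Node N) (Node N') = (\<Sum>M\<in>couplings N N'.
      pois_family (X d \<times> X d) ?q M * pois_family (X d) ?u (\<lambda>\<tau>. count N \<tau> - rowsum M \<tau>)
        * pois_family (X d) ?u (\<lambda>\<tau>. count N' \<tau> - colsum M \<tau>))"
    using N by simp
  also have "\<dots> = (\<Sum>M\<in>pair_msets N N'.
      pois_family (X d \<times> X d) ?q (count M) * pois_family (X d) ?u (\<lambda>\<tau>. count N \<tau> - rowsum (count M) \<tau>)
        * pois_family (X d) ?u (\<lambda>\<tau>. count N' \<tau> - colsum (count M) \<tau>))"
    by (rule sum.reindex_bij_betw[OF bij_betw_count_couplings, symmetric])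
  also have "\<dots> = (\<Sum>M\<in>pair_msets N N'. exp (- (lam * s) - 2 * (lam * (1 - s))) *
      (mweight ?q M * mweight ?u (N - image_mset fst M) * mweight ?u (N' - image_mset snd M)))"
  proof (rule sum.cong[OF refl])
    fix M assume M: "M \<in> pair_msets N N'"
    have "M \<in> msets (X d \<times> X d)"
      using pair_msets_member[OF M] N by (fastforce simp: msets_def)
    then have 1: "pois_family (X d \<times> X d) ?q (count M) = exp (- (lam * s)) * mweight ?q M"
      by (simp add: pois_family_count q)
    have diff: "(\<lambda>\<tau>. count N \<tau> - rowsum (count M) \<tau>) = count (N - image_mset fst M)"
      "(\<lambda>\<tau>. count N' \<tau> - colsum (count M) \<tau>) = count (N' - image_mset snd M)"
      by (auto simp: rowsum_count colsum_count)
    have 2: "pois_family (X d) ?u (count (K - K')) = exp (- (lam * (1 - s))) * mweight ?u (K - K')"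
      if "K \<in> msets (X d)" for K K'
      using that by (simp add: pois_family_count u)
    have e: "exp (- (lam * s) - 2 * (lam * (1 - s))) = exp (- (lam * s)) * exp (- (lam * (1 - s))) * exp (- (lam * (1 - s)))"
      by (simp flip: exp_add)
    show "pois_family (X d \<times> X d) ?q (count M) * pois_family (X d) ?u (\<lambda>\<tau>. count N \<tau> - rowsum (count M) \<tau>)
        * pois_family (X d) ?u (\<lambda>\<tau>. count N' \<tau> - colsum (count M) \<tau>) = exp (- (lam * s) - 2 * (lam * (1 - s))) *
      (mweight ?q M * mweight ?u (N - image_mset fst M) * mweight ?u (N' - image_mset snd M))"
      unfolding diff 1 2[OF N(1)] 2[OF N(2)] e by simp
  qed
  finally show ?thesis by (simp add: coupling_sum_def sum_distrib_left)
qed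

lemma LR_recursion:
  assumes lam: "lam > 0" and marg: "LR_marginal lam s d"
  defines "L \<equiv> \<lambda>N N'. LR lam s (Suc d) (Node N) (Node N')"
  shows "N' \<in> msets (X d) \<Longrightarrow> L {#} N' = exp (lam * s) * (1 - s) ^ size N'"
    and "x \<in> X d \<Longrightarrow> N \<in> msets (X d) \<Longrightarrow> N' \<in> msets (X d) \<Longrightarrow>
        L (add_mset x N) N' = (1 - s) * L N N' + s / lam * (\<Sum>y\<in>#N'. LR lam s d x y * L N (N' - {#y#}))"
proof -
  have pc: "poisson_charlier lam (GW lam d) (X d) (tree_charlier lam d) (X d) leaf" and pos: "\<And>t. t \<in> X d \<Longrightarrow> GW lam d t > 0"
    using poisson_charlier_trees[OF lam] by auto
  interpret poisson_charlier lam "GW lam d" "X d" "tree_charlier lam d" "X d" leaf by fact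
  let ?q = "\<lambda>(x, y). lam * s * Pcorr lam s d x y" and ?u = "\<lambda>x. lam * (1 - s) * GW lam d x"
  have L: "L N N' = exp (- (lam * s) - 2 * (lam * (1 - s))) * coupling_sum ?q ?u ?u N N' / (prob N * prob N')"
    if "N \<in> msets (X d)" "N' \<in> msets (X d)" for N N'
    using that by (simp add: L_def LR_def Pcorr_Suc_Node[OF lam marg] GW_Suc_Node[OF pc] del: GW.simps Pcorr.simps)
  have q: "?q (x, y) = lam * s * (GW lam d x * GW lam d y * LR lam s d x y)" if "x \<in> X d" "y \<in> X d" for x y
    using that by (simp add: Pcorr_LR[OF lam])
  note * = coupling_ratio_recursion[where q = ?q and u = ?u and s = s and l = "LR lam s d" and L = L, OF pos q refl L]
  show "N' \<in> msets (X d) \<Longrightarrow> L {#} N' = exp (lam * s) * (1 - s) ^ size N'"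
    by (rule *(1))
  show "x \<in> X d \<Longrightarrow> N \<in> msets (X d) \<Longrightarrow> N' \<in> msets (X d) \<Longrightarrow>
        L (add_mset x N) N' = (1 - s) * L N N' + s / lam * (\<Sum>y\<in>#N'. LR lam s d x y * L N (N' - {#y#}))"
    by (rule *(2))
qed

lemma LR_0: "t \<in> X 0 \<Longrightarrow> t' \<in> X 0 \<Longrightarrow> LR lam s 0 t t' = 1"
  by (simp add: X_0 LR_def)

text \<open>The recursion of the ratio at depth d + 1 rests on the mass at depth d, and
  \<open>kernel_marginal\<close> turns it into the marginal at depth d + 1.\<close>

lemma LR_marginal:
  assumes lam: "lam > 0" and s: "0 \<le> s" "s \<le> 1"
  shows "LR_marginal lam s d"
proof (induction d)
  case 0
  show ?case by (simp add: LR_marginal_def X_0 LR_def has_sum_finite_iff)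
next
  case (Suc d)
  have pc: "poisson_charlier lam (GW lam d) (X d) (tree_charlier lam d) (X d) leaf" and pos: "\<And>t. t \<in> X d \<Longrightarrow> GW lam d t > 0"
    using poisson_charlier_trees[OF lam] by auto
  interpret poisson_charlier lam "GW lam d" "X d" "tree_charlier lam d" "X d" leaf by fact
  note rec = LR_recursion[OF lam Suc]
  have "((\<lambda>N'. prob N' * LR lam s (Suc d) (Node N) (Node N')) has_sum 1) (msets (X d))"
    if "N \<in> msets (X d)" for N
    by (rule kernel_marginal[where s = s and l = "LR lam s d"
          and L = "\<lambda>N N'. LR lam s (Suc d) (Node N) (Node N')", OF rec s(2) _ that])
       (use Suc in \<open>auto simp: LR_marginal_def\<close>)
  then have "((\<lambda>N'. GW lam (Suc d) (Node N') * LR lam s (Suc d) (Node N) (Node N')) has_sum 1) (msets (X d))"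
    if "N \<in> msets (X d)" for N
    using that by (simp add: GW_Suc_Node[OF pc] del: GW.simps cong: has_sum_cong)
  then have "((\<lambda>t'. GW lam (Suc d) t' * LR lam s (Suc d) t t') has_sum 1) (X (Suc d))" if "t \<in> X (Suc d)" for t
    using that unfolding has_sum_X_Suc by (cases t) (simp del: GW.simps)
  moreover have "Pcorr lam s (Suc d) t t' \<ge> 0" if t: "t \<in> X (Suc d)" "t' \<in> X (Suc d)" for t t'
  proof -
    obtain N N' where N: "t = Node N" "t' = Node N'" "N \<in> msets (X d)" "N' \<in> msets (X d)"
      using t by (cases t; cases t') auto
    have "coupling_sum (\<lambda>(x, y). lam * s * Pcorr lam s d x y)
      (\<lambda>x. lam * (1 - s) * GW lam d x) (\<lambda>x. lam * (1 - s) * GW lam d x) N N' \<ge> 0"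
    proof (rule coupling_sum_nonneg)
      have "GW lam d x \<ge> 0" if "x \<in> X d" for x using pos[OF that] by simp
      then show "lam * (1 - s) * GW lam d x \<ge> 0" if "x \<in># N" for x
        using that N(3) lam s by (auto intro!: mult_nonneg_nonneg dest: msets_member)
      with N(4) show "lam * (1 - s) * GW lam d x \<ge> 0" if "x \<in># N'" for x
        using that lam s pos by (intro mult_nonneg_nonneg less_imp_le[OF pos]) (auto dest: msets_member)
      show "(case (x, y) of (x, y) \<Rightarrow> lam * s * Pcorr lam s d x y) \<ge> 0" if "x \<in># N" "y \<in># N'" for x y
        using msets_member[OF N(3) that(1)] msets_member[OF N(4) that(2)] lam s Suc
        by (simp add: LR_marginal_def)
    qed
    then show ?thesis
      unfolding N(1,2) Pcorr_Suc_Node[OF lam Suc N(3,4)] by simp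
  qed
  ultimately show ?case by (auto simp: LR_marginal_def simp del: GW.simps Pcorr.simps)
qed

lemma LR_expansion:
  assumes lam: "lam > 0" and s: "0 \<le> s" "s \<le> 1" and "t \<in> X d" "t' \<in> X d"
  shows "((\<lambda>\<beta>. s ^ (tsize \<beta> - 1) * tree_charlier lam d \<beta> t * tree_charlier lam d \<beta> t') has_sum LR lam s d t t') (X d)"
  using assms(4-)
proof (induction d arbitrary: t t')
  case 0
  then show ?case by (simp add: LR_0) (simp add: X_0 has_sum_finite_iff leaf_def)
next
  case (Suc d)
  note rec = LR_recursion[OF lam LR_marginal[OF lam s, of d]]
  have "((\<lambda>\<beta>. s ^ (tsize \<beta> - 1) * tree_charlier lam (Suc d) \<beta> t * tree_charlier lam (Suc d) \<beta> t') has_sum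
      LR lam s (Suc d) (Node (children t)) (Node (children t'))) (X (Suc d))"
    by (rule has_sum_tree_kernel[where l = "LR lam s d" and L = "\<lambda>N N'. LR lam s (Suc d) (Node N) (Node N')",
          OF lam s(1) _ Suc.IH rec Suc.prems])
       (use poisson_charlier_trees[OF lam] in auto)
  then show ?case by (cases t; cases t') simp
qed

text \<open>At s = 1 the correlated model lives on equal trees. Combined with the expansion, this is
  the completeness relation.\<close>

lemma LR_one:
  assumes lam: "lam > 0" and "t \<in> X d" "t' \<in> X d"
  shows "LR lam 1 d t t' = (if t = t' then 1 / GW lam d t else 0)"
  using assms(2-)
proof (induction d arbitrary: t t')
  case 0
  then show ?case by (simp add: LR_0) (simp add: X_0)
next
  case (Suc d)
  have pc: "poisson_charlier lam (GW lam d) (X d) (tree_charlier lam d) (X d) leaf" and pos: "\<And>t. t \<in> X d \<Longrightarrow> GW lam d t > 0"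
    using poisson_charlier_trees[OF lam] by auto
  interpret poisson_charlier lam "GW lam d" "X d" "tree_charlier lam d" "X d" leaf by fact
  note rec = LR_recursion[OF lam LR_marginal[OF lam zero_le_one order.refl, of d]]
  obtain N N' where N: "t = Node N" "t' = Node N'" "N \<in> msets (X d)" "N' \<in> msets (X d)"
    using Suc.prems by (cases t; cases t') auto
  have "LR lam 1 (Suc d) (Node N) (Node N') = (if N = N' then 1 / prob N else 0)"
    by (rule kernel_diagonal[where l = "LR lam 1 d" and L = "\<lambda>N N'. LR lam 1 (Suc d) (Node N) (Node N')",
          OF rec refl Suc.IH pos N(3,4)])
  then show ?case using N GW_Suc_Node[OF pc N(3)] by (auto simp del: GW.simps)
qed

section \<open>Pairing numbers over all labels and the limit on trees\<close>

text \<open>Labels are paired only with equal labels, so the pairing number factorises over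
  \<gamma>; a label that does not occur gives 1. Exponents are cut to {1..n} because b may be
  arbitrary outside.\<close>

definition wick_product :: "nat \<Rightarrow> (nat \<Rightarrow> 'a multiset) \<Rightarrow> real" where
  "wick_product n b = (\<Prod>\<gamma>\<in>(\<Union>i\<in>{1..n}. set_mset (b i)). wick n (\<lambda>i. if i \<in> {1..n} then count (b i) \<gamma> else 0))"

lemma wick_product_empty: "\<forall>i\<in>{1..n}. b i = {#} \<Longrightarrow> wick_product n b = 1"
  by (simp add: wick_product_def)

lemma wick_product_superset:
  assumes "finite S" "(\<Union>i\<in>{1..n}. set_mset (b i)) \<subseteq> S"
  shows "wick_product n b = (\<Prod>\<gamma>\<in>S. wick n (\<lambda>i. if i \<in> {1..n} then count (b i) \<gamma> else 0))"
  unfolding wick_product_def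
proof (rule prod.mono_neutral_left[OF assms])
  show "\<forall>\<gamma>\<in>S - (\<Union>i\<in>{1..n}. set_mset (b i)). wick n (\<lambda>i. if i \<in> {1..n} then count (b i) \<gamma> else 0) = 1"
  proof
    fix \<gamma> assume "\<gamma> \<in> S - (\<Union>i\<in>{1..n}. set_mset (b i))"
    then have "(\<lambda>i. if i \<in> {1..n} then count (b i) \<gamma> else 0) = (\<lambda>_. 0)"
      by (auto simp: fun_eq_iff not_in_iff)
    then show "wick n (\<lambda>i. if i \<in> {1..n} then count (b i) \<gamma> else 0) = 1" by simp
  qed
qed

text \<open>Pairing a label g affects only the factor of g, where \<open>wick_recursion\<close>
  applies. This is the premise \<open>TS\<close> of \<open>moment_tendsto_le\<close>.\<close>

lemma wick_product_recursion:
  assumes i: "i \<in> {1..n}" and b: "b i = add_mset g c"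
  shows "wick_product n b = (\<Sum>j\<in>{1..n} - {i}. real (count (b j) g) * wick_product n (b(i := c, j := b j - {#g#})))"
proof -
  define S where "S = (\<Union>i\<in>{1..n}. set_mset (b i))"
  define cnt where "cnt b \<gamma> = (\<lambda>i. if i \<in> {1..n} then count (b i) \<gamma> else 0)" for b :: "nat \<Rightarrow> 'a multiset" and \<gamma>
  have fin: "finite S" and g: "g \<in> S" using i b by (auto simp: S_def intro!: bexI[of _ i])
  define R where "R = (\<Prod>\<gamma>\<in>S - {g}. wick n (cnt b \<gamma>))"
  have fs: "finsupp (cnt b g)"
    unfolding finsupp_def by (rule finite_subset[of _ "{1..n}"]) (auto simp: cnt_def)
  have "wick_product n b = wick n (cnt b g) * R"
    unfolding wick_product_def S_def[symmetric] cnt_def[symmetric] R_def using fin g by (rule prod.remove)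
  also have "wick n (cnt b g) = (\<Sum>j\<in>{1..n} - {i}. real (cnt b g j) * wick n ((cnt b g)(i := cnt b g i - 1, j := cnt b g j - 1)))"
    by (rule wick_recursion[OF fs i]) (use i b in \<open>simp add: cnt_def\<close>)
  also have "\<dots> * R = (\<Sum>j\<in>{1..n} - {i}. real (cnt b g j) * wick n ((cnt b g)(i := cnt b g i - 1, j := cnt b g j - 1)) * R)"
    by (rule sum_distrib_right)
  also have "\<dots> = (\<Sum>j\<in>{1..n} - {i}. real (count (b j) g) * wick_product n (b(i := c, j := b j - {#g#})))"
  proof (rule sum.cong[OF refl])
    fix j assume j: "j \<in> {1..n} - {i}"
    let ?b = "b(i := c, j := b j - {#g#})"
    have sub: "(\<Union>k\<in>{1..n}. set_mset (?b k)) \<subseteq> S"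
    proof
      fix x assume "x \<in> (\<Union>k\<in>{1..n}. set_mset (?b k))"
      then obtain k where k: "k \<in> {1..n}" "x \<in># ?b k" by auto
      then have "x \<in># b k" using b by (auto split: if_splits dest: in_diffD)
      then show "x \<in> S" using k(1) by (auto simp: S_def)
    qed
    have "wick_product n ?b = (\<Prod>\<gamma>\<in>S. wick n (cnt ?b \<gamma>))"
      unfolding cnt_def by (rule wick_product_superset[OF fin sub])
    also have "\<dots> = wick n (cnt ?b g) * (\<Prod>\<gamma>\<in>S - {g}. wick n (cnt ?b \<gamma>))"
      using fin g by (rule prod.remove)
    also have "(\<Prod>\<gamma>\<in>S - {g}. wick n (cnt ?b \<gamma>)) = R"
      unfolding R_def
    proof (rule prod.cong[OF refl])
      fix \<gamma> assume "\<gamma> \<in> S - {g}"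
      then have "cnt ?b \<gamma> = cnt b \<gamma>" using b by (auto simp: cnt_def fun_eq_iff)
      then show "wick n (cnt ?b \<gamma>) = wick n (cnt b \<gamma>)" by simp
    qed
    also have "cnt ?b g = (cnt b g)(i := cnt b g i - 1, j := cnt b g j - 1)"
      using i j b by (auto simp: cnt_def fun_eq_iff)
    finally have W: "wick_product n ?b = wick n ((cnt b g)(i := cnt b g i - 1, j := cnt b g j - 1)) * R" .
    have "cnt b g j = count (b j) g" using j by (simp add: cnt_def)
    then show "real (cnt b g j) * wick n ((cnt b g)(i := cnt b g i - 1, j := cnt b g j - 1)) * R =
        real (count (b j) g) * wick_product n ?b"
      by (simp only: W mult.assoc)
  qed
  finally show ?thesis .
qed

lemma sqrt_prod: "sqrt (\<Prod>x\<in>A. f x) = (\<Prod>x\<in>A. sqrt (f x))"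
  by (induction A rule: infinite_finite_induct) (auto simp: real_sqrt_mult)

text \<open>Exchanging the products over i and \<gamma> in the normalisation yields sqrt of the same
  factorials that \<open>wick\<close> contains, so one square root of them survives.\<close>

lemma wick_product_normalized:
  "wick_product n b / (\<Prod>i=1..n. sqrt (mfact (b i))) =
    (\<Prod>\<gamma>\<in>(\<Union>i\<in>{1..n}. set_mset (b i)). sqrt (\<Prod>i=1..n. fact (count (b i) \<gamma>)) *
       mps_exp (pair_sum n) (\<lambda>i. if i \<in> {1..n} then count (b i) \<gamma> else 0))"
proof -
  define S where "S = (\<Union>i\<in>{1..n}. set_mset (b i))"
  have fin: "finite S" by (auto simp: S_def)
  define f where "f \<gamma> = (\<Prod>i=1..n. fact (count (b i) \<gamma>) :: real)" for \<gamma>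
  have fpos: "f \<gamma> > 0" for \<gamma> unfolding f_def by (intro prod_pos) auto
  have "(\<Prod>i=1..n. mfact (b i)) = (\<Prod>i=1..n. \<Prod>\<gamma>\<in>S. fact (count (b i) \<gamma>))"
    using fin by (intro prod.cong refl mfact_superset) (auto simp: S_def)
  also have "\<dots> = (\<Prod>\<gamma>\<in>S. f \<gamma>)" unfolding f_def by (rule prod.swap)
  finally have "(\<Prod>i=1..n. sqrt (mfact (b i))) = sqrt (\<Prod>\<gamma>\<in>S. f \<gamma>)"
    by (simp flip: sqrt_prod)
  then have den: "(\<Prod>i=1..n. sqrt (mfact (b i))) = (\<Prod>\<gamma>\<in>S. sqrt (f \<gamma>))"
    by (simp add: sqrt_prod)
  have "wick n (\<lambda>i. if i \<in> {1..n} then count (b i) \<gamma> else 0) / sqrt (f \<gamma>) =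
      sqrt (f \<gamma>) * mps_exp (pair_sum n) (\<lambda>i. if i \<in> {1..n} then count (b i) \<gamma> else 0)" for \<gamma>
  proof -
    have "(\<Prod>i=1..n. fact (if i \<in> {1..n} then count (b i) \<gamma> else 0) :: real) = f \<gamma>"
      unfolding f_def by (intro prod.cong) auto
    then show ?thesis using fpos[of \<gamma>] real_div_sqrt[of "f \<gamma>"]
      by (simp add: wick_def field_simps)
  qed
  then show ?thesis
    unfolding den wick_product_def S_def[symmetric] f_def[symmetric] prod_dividef[symmetric] by simp
qed

lemma tree_charlier_moments_tendsto:
  assumes mom: "\<And>gs. gs \<in> msets (X d) \<Longrightarrow>
     \<exists>v. ((\<lambda>lam. poisson_charlier.mom (GW lam d) (X d) (tree_charlier lam d) gs) \<longlongrightarrow> v) at_top"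
    and \<beta>: "\<forall>i\<in>{1..n}. \<beta> i \<in> X (Suc d)"
  shows "((\<lambda>lam. poisson_charlier.moment lam (GW lam d) (X d) (tree_charlier lam d) leaf {1..n} (\<lambda>i. children (\<beta> i)) /
     (\<Prod>i=1..n. sqrt (mfact (children (\<beta> i))))) \<longlongrightarrow>
     wick_product n (\<lambda>i. children (\<beta> i)) / (\<Prod>i=1..n. sqrt (mfact (children (\<beta> i))))) at_top"
proof (rule tendsto_divide[OF _ tendsto_const])
  show "((\<lambda>lam. poisson_charlier.moment lam (GW lam d) (X d) (tree_charlier lam d) leaf {1..n} (\<lambda>i. children (\<beta> i))) \<longlongrightarrow>
     wick_product n (\<lambda>i. children (\<beta> i))) at_top"
    by (rule moment_tendsto[where B = "X d", OF _ _ mom wick_product_empty wick_product_recursion])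
       (use poisson_charlier_trees \<beta> in \<open>auto simp: children_in_msets\<close>)
  show "(\<Prod>i=1..n. sqrt (mfact (children (\<beta> i)))) \<noteq> 0"
    by simp
qed

text \<open>Closes the induction in the limit: a moment at depth d + 1 is a normalised Charlier
  moment over depth d, whose convergence needs only that the moments at depth d converge.\<close>

lemma tree_charlier_mom_convergent:
  "gs \<in> msets (X d) \<Longrightarrow> \<exists>v. ((\<lambda>lam. poisson_charlier.mom (GW lam d) (X d) (tree_charlier lam d) gs) \<longlongrightarrow> v) at_top"
proof (induction d arbitrary: gs)
  case 0
  have "\<forall>\<^sub>F lam in at_top. 1 = poisson_charlier.mom (GW lam 0) (X 0) (tree_charlier lam 0) gs"
    using eventually_gt_at_top[of 0]
  proof eventually_elim
    case (elim lam)
    show ?case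
      using poisson_charlier.mom_def[OF conjunct1[OF poisson_charlier_trees[OF elim, of 0]], of gs] by (simp add: X_0)
  qed
  then show ?case using tendsto_cong tendsto_const by fastforce
next
  case (Suc d)
  obtain \<beta> where \<beta>: "\<forall>i\<in>{1..size gs}. \<beta> i \<in># gs"
    "\<forall>F :: tree \<Rightarrow> real. (\<Prod>g\<in>#gs. F g) = (\<Prod>i=1..size gs. F (\<beta> i))"
    using prod_mset_as_prod[of gs] by blast
  then have \<beta>X: "\<forall>i\<in>{1..size gs}. \<beta> i \<in> X (Suc d)" using Suc.prems by (auto dest: msets_member)
  have "\<forall>\<^sub>F lam in at_top. poisson_charlier.moment lam (GW lam d) (X d) (tree_charlier lam d) leaf {1..size gs} (\<lambda>i. children (\<beta> i)) /
     (\<Prod>i=1..size gs. sqrt (mfact (children (\<beta> i)))) = poisson_charlier.mom (GW lam (Suc d)) (X (Suc d)) (tree_charlier lam (Suc d)) gs"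
    using eventually_gt_at_top[of 0]
  proof eventually_elim
    case (elim lam)
    show ?case
      unfolding poisson_charlier.mom_def[OF conjunct1[OF poisson_charlier_trees[OF elim, of "Suc d"]]] \<beta>(2)[rule_format]
      by (rule infsumI[symmetric], rule tree_charlier_moment) (use poisson_charlier_trees[OF elim] \<beta>X in auto)
  qed
  from Lim_transform_eventually[OF tree_charlier_moments_tendsto[OF Suc.IH \<beta>X] this] show ?case
    by blast
qed

theorem theorem4:
  "\<exists>f :: real \<Rightarrow> nat \<Rightarrow> tree \<Rightarrow> tree \<Rightarrow> real.
     (\<forall>lam > 0. \<forall>d.
        (\<forall>s \<in> {0..1}. \<forall>t \<in> X d. \<forall>t' \<in> X d.
           ((\<lambda>\<beta>. s ^ (tsize \<beta> - 1) * f lam d \<beta> t * f lam d \<beta> t') has_sum LR lam s d t t') (X d))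
      \<and> (\<forall>t \<in> X d. f lam d leaf t = 1)
      \<and> (\<forall>\<beta> \<in> X d. \<forall>\<beta>' \<in> X d.
           ((\<lambda>t. GW lam d t * f lam d \<beta> t * f lam d \<beta>' t) has_sum (if \<beta> = \<beta>' then 1 else 0)) (X d))
      \<and> (\<forall>t \<in> X d. \<forall>t' \<in> X d.
           ((\<lambda>\<beta>. f lam d \<beta> t * f lam d \<beta> t') has_sum (if t = t' then 1 / GW lam d t else 0)) (X d)))
   \<and> (\<forall>d \<ge> 1. \<forall>n \<ge> 2. \<forall>\<beta> :: nat \<Rightarrow> tree. (\<forall>i \<in> {1..n}. \<beta> i \<in> X d) \<longrightarrow>
        (\<exists>S :: real \<Rightarrow> real.
           (\<forall>lam > 0. ((\<lambda>t. GW lam d t * (\<Prod>i = 1..n. f lam d (\<beta> i) t)) has_sum S lam) (X d))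
         \<and> (S \<longlongrightarrow>
              (\<Prod>\<gamma> \<in> (\<Union>i \<in> {1..n}. set_mset (children (\<beta> i))).
                 sqrt (\<Prod>i = 1..n. fact (count (children (\<beta> i)) \<gamma>))
                 * mps_exp (pair_sum n)
                     (\<lambda>i. if i \<in> {1..n} then count (children (\<beta> i)) \<gamma> else 0)))
             at_top))"
proof (intro exI[of _ tree_charlier] conjI allI impI ballI)
  fix lam :: real and d assume lam: "lam > 0"
  interpret poisson_charlier lam "GW lam d" "X d" "tree_charlier lam d" "X d" leaf
    using poisson_charlier_trees[OF lam] by blast
  {
    fix s t t' assume "s \<in> {0..1::real}" "t \<in> X d" "t' \<in> X d"
    then show "((\<lambda>\<beta>. s ^ (tsize \<beta> - 1) * tree_charlier lam d \<beta> t * tree_charlier lam d \<beta> t') has_sum LR lam s d t t') (X d)"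
      using LR_expansion[OF lam] by simp
  next
    fix t show "tree_charlier lam d leaf t = 1" by (rule tree_charlier_leaf)
  next
    fix \<beta> \<beta>' assume "\<beta> \<in> X d" "\<beta>' \<in> X d"
    then show "((\<lambda>t. GW lam d t * tree_charlier lam d \<beta> t * tree_charlier lam d \<beta>' t) has_sum (if \<beta> = \<beta>' then 1 else 0)) (X d)"
      by (rule orthonormal)
  next
    fix t t' assume t: "t \<in> X d" "t' \<in> X d"
    \<comment> \<open>The expansion at s = 1, where every power of s equals 1.\<close>
    show "((\<lambda>\<beta>. tree_charlier lam d \<beta> t * tree_charlier lam d \<beta> t') has_sum (if t = t' then 1 / GW lam d t else 0)) (X d)"
      using LR_expansion[OF lam zero_le_one order.refl t] LR_one[OF lam t] by simp
  }
next
  fix d n :: nat and \<beta> :: "nat \<Rightarrow> tree"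
  assume "1 \<le> d" and "\<forall>i\<in>{1..n}. \<beta> i \<in> X d"
  then obtain e where d: "d = Suc e" and \<beta>: "\<forall>i\<in>{1..n}. \<beta> i \<in> X (Suc e)"
    by (cases d) auto
  have "((\<lambda>t. GW lam (Suc e) t * (\<Prod>i=1..n. tree_charlier lam (Suc e) (\<beta> i) t)) has_sum
      poisson_charlier.moment lam (GW lam e) (X e) (tree_charlier lam e) leaf {1..n} (\<lambda>i. children (\<beta> i)) /
      (\<Prod>i=1..n. sqrt (mfact (children (\<beta> i))))) (X (Suc e))" if "lam > 0" for lam
    using poisson_charlier_trees[OF that, of e] \<beta> by (intro tree_charlier_moment) auto
  with tree_charlier_moments_tendsto[OF tree_charlier_mom_convergent \<beta>]
  show "\<exists>S. (\<forall>lam>0. ((\<lambda>t. GW lam d t * (\<Prod>i=1..n. tree_charlier lam d (\<beta> i) t)) has_sum S lam) (X d)) \<and>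
      (S \<longlongrightarrow> (\<Prod>\<gamma>\<in>(\<Union>i\<in>{1..n}. set_mset (children (\<beta> i))).
         sqrt (\<Prod>i=1..n. fact (count (children (\<beta> i)) \<gamma>)) *
         mps_exp (pair_sum n) (\<lambda>i. if i \<in> {1..n} then count (children (\<beta> i)) \<gamma> else 0))) at_top"
    unfolding wick_product_normalized d
    by (intro exI[of _ "\<lambda>lam. poisson_charlier.moment lam (GW lam e) (X e) (tree_charlier lam e) leaf {1..n} (\<lambda>i. children (\<beta> i)) /
      (\<Prod>i=1..n. sqrt (mfact (children (\<beta> i))))"] conjI) blast+
qed

end
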